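(* Let $\Gamma$ be a tropical curve with a forbidden pattern which is a crowded graph. Then $\Gamma$ does not admit a degree $3$ well-contracted cover, up to tropical modifications; that is, no tropical modification of $\Gamma$ (including $\Gamma$ itself) admits a well-contracted cover of degree $3$.
   Context: **Pattern.** A tropical curve is a connected metric graph $\Gamma$ (with a genus function on points); the pattern refers to its canonical model (obtained by shrinking unbounded ends and, iteratively, leaf edges). $\Gamma$ is a crowded graph if it consists of two 3-valent vertices $v_1,v_2$, three pairwise disjoint connected subgraphs $\Gamma_1,\Gamma_2,\Gamma_3$ of positive genus (each contains a cycle) not containing $v_1,v_2$, and, for each $i\in\{1,2,3\}$, one edge $e_i$ joining $v_1$ to a vertex of $\Gamma_i$ and one edge $e_i'$ joining $v_2$ to a vertex of $\Gamma_i$, with no further edges. **Modifications.** A tropical modification of $\Gamma$ is a metric graph with the same canonical model obtained by gluing trees (possibly with unbounded edges) to $\Gamma$ at some points. **Covers.** A model of a metric graph is a pair $(G,l)$, a graph with edge lengths; models may be refined by adding 2-valent vertices. A continuous map $\varphi:\Gamma_1\to\Gamma_2$ of metric graphs is a morphism if for suitable models $(G_1,l_1),(G_2,l_2)$ one has $\varphi(V(G_1))\subset V(G_2)$, $\varphi^{-1}(E(G_2))\subset E(G_1)$, and for each $e\in E(G_1)$ the number $\mu_\varphi(e)$, defined as $l_2(\varphi(e))/l_1(e)$ if $\varphi(e)$ is an edge and as $0$ if $\varphi(e)$ is a vertex ($e$ is contracted), is a nonnegative integer, positive in the first case (for unbounded edges $\mu_\varphi(e)$ is the slope). It is non-degenerate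 if every vertex $v$ has an incident edge $e$ with $\mu_\varphi(e)>0$ and no loop is contracted. It is harmonic if for each vertex $v$ the number $m_\varphi(v)=\sum_{e\ni v,\ \varphi(e)=e'}\mu_\varphi(e)$ does not depend on the edge $e'$ at $\varphi(v)$; its degree is $\sum_{\varphi(e)=e'}\mu_\varphi(e)$, independent of the edge $e'$ of the target. A tropical cover of degree $d$ is a harmonic morphism of degree $d$ such that for every vertex $v$ whose image has valence at least $2$, $(2m_\varphi(v)-2)-\sum_{e\ni v}(\mu_\varphi(e)-1)\ge 0$ (sum over all outgoing edges at $v$, contracted ones included). A path is a metric tree homeomorphic to an interval (possibly unbounded). A well-contracted cover is a non-degenerate tropical cover whose target is a path. *)

theory Defs
  imports "HOL-Analysis.Analysis"
begin

section \<open>Metric graphs and their models\<close>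

text \<open>
  A model is a finite graph with edge lengths, drawn on a set of points: the vertices are points
  and the edges are pairwise disjoint sets of points, each parametrised by arc length. The chart of
  an edge \<open>e\<close> sends the open interval from 0 to \<open>len e\<close> bijectively to \<open>e\<close>; its value at 0, and at
  \<open>len e\<close> if that is finite, is an end vertex. Thus an unbounded edge is a half-open ray with a
  single end vertex (there are no points at infinity), and \<open>tgt\<close> is meaningful only for bounded
  edges. Loops and parallel edges are allowed.
\<close>

record 'a model =
  verts :: "'a set"
  edges :: "'a set set"
  len :: "'a set \<Rightarrow> ereal"
  chart :: "'a set \<Rightarrow> real \<Rightarrow> 'a"

definition open_dom :: "'a model \<Rightarrow> 'a set \<Rightarrow> real set" where
  "open_dom M e = {t. 0 < t \<and> ereal t < len M e}"

definition closed_dom :: "'a model \<Rightarrow> 'a set \<Rightarrow> real set" where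
  "closed_dom M e = {t. 0 \<le> t \<and> ereal t \<le> len M e}"

definition bounded_edge :: "'a model \<Rightarrow> 'a set \<Rightarrow> bool" where
  "bounded_edge M e \<longleftrightarrow> e \<in> edges M \<and> len M e < \<infinity>"

definition src :: "'a model \<Rightarrow> 'a set \<Rightarrow> 'a" where
  "src M e = chart M e 0"

definition tgt :: "'a model \<Rightarrow> 'a set \<Rightarrow> 'a" where
  "tgt M e = chart M e (real_of_ereal (len M e))"

definition points :: "'a model \<Rightarrow> 'a set" where
  "points M = verts M \<union> \<Union> (edges M)"

definition metric_graph :: "'a model \<Rightarrow> bool" where
  "metric_graph M \<longleftrightarrow>
     finite (verts M) \<and> verts M \<noteq> {} \<and> finite (edges M) \<and>
     pairwise disjnt (edges M) \<and> (\<forall>e\<in>edges M. disjnt e (verts M)) \<and>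
     (\<forall>e\<in>edges M. 0 < len M e \<and> bij_betw (chart M e) (open_dom M e) e \<and> src M e \<in> verts M) \<and>
     (\<forall>e. bounded_edge M e \<longrightarrow> tgt M e \<in> verts M)"

text \<open>The quotient topology obtained by gluing the closed edges along the vertices.\<close>

definition graph_topology :: "'a model \<Rightarrow> 'a topology" where
  "graph_topology M = topology (\<lambda>U. U \<subseteq> points M \<and>
     (\<forall>e\<in>edges M. openin (top_of_set (closed_dom M e)) {t \<in> closed_dom M e. chart M e t \<in> U}))"

lemma openin_graph_topology:
  "openin (graph_topology M) U \<longleftrightarrow> U \<subseteq> points M \<and>
     (\<forall>e\<in>edges M. openin (top_of_set (closed_dom M e)) {t \<in> closed_dom M e. chart M e t \<in> U})"
proof -
  let ?P = "\<lambda>U. U \<subseteq> points M \<and>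
     (\<forall>e\<in>edges M. openin (top_of_set (closed_dom M e)) {t \<in> closed_dom M e. chart M e t \<in> U})"
  have "istopology ?P"
    unfolding istopology_def
  proof (intro conjI allI impI)
    fix S T assume S: "?P S" and T: "?P T"
    have "openin (top_of_set (closed_dom M e)) {t \<in> closed_dom M e. chart M e t \<in> S \<inter> T}"
      if "e \<in> edges M" for e
    proof -
      have "{t \<in> closed_dom M e. chart M e t \<in> S \<inter> T} =
        {t \<in> closed_dom M e. chart M e t \<in> S} \<inter> {t \<in> closed_dom M e. chart M e t \<in> T}" by auto
      then show ?thesis using S T that by (simp add: openin_Int)
    qed
    then show "S \<inter> T \<subseteq> points M" "\<forall>e\<in>edges M.
      openin (top_of_set (closed_dom M e)) {t \<in> closed_dom M e. chart M e t \<in> S \<inter> T}"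
      using S by auto
  next
    fix K assume K: "\<forall>S\<in>K. ?P S"
    have "openin (top_of_set (closed_dom M e)) {t \<in> closed_dom M e. chart M e t \<in> \<Union>K}"
      if "e \<in> edges M" for e
    proof -
      have "{t \<in> closed_dom M e. chart M e t \<in> \<Union>K} =
        (\<Union>S\<in>K. {t \<in> closed_dom M e. chart M e t \<in> S})" by auto
      then show ?thesis using K that by (auto intro!: openin_Union)
    qed
    then show "\<Union>K \<subseteq> points M" "\<forall>e\<in>edges M.
      openin (top_of_set (closed_dom M e)) {t \<in> closed_dom M e. chart M e t \<in> \<Union>K}"
      using K by auto
  qed
  then show ?thesis unfolding graph_topology_def by simp
qed

text \<open>
  \<open>R\<close> arises from \<open>M\<close> by adding 2-valent vertices: same points, more vertices, and every edge of
  \<open>R\<close> is a segment of an edge of \<open>M\<close>, traversed at unit speed in one of the two directions. Two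
  models present the same metric graph iff they have a common refinement; a metric graph is given
  below by any of its models.
\<close>

definition refines :: "'a model \<Rightarrow> 'a model \<Rightarrow> bool" where
  "refines R M \<longleftrightarrow> metric_graph R \<and> metric_graph M \<and>
     points R = points M \<and> verts M \<subseteq> verts R \<and>
     (\<forall>e\<in>edges R. \<exists>f\<in>edges M. \<exists>a. \<exists>s\<in>{1, -1}. \<forall>t\<in>closed_dom R e.
        a + s * t \<in> closed_dom M f \<and> chart R e t = chart M f (a + s * t))"

definition model_of :: "'a model \<Rightarrow> 'a model \<Rightarrow> bool" where
  "model_of N M \<longleftrightarrow> (\<exists>R. refines R N \<and> refines R M)"

definition connected_graph :: "'a model \<Rightarrow> bool" where
  "connected_graph M \<longleftrightarrow> metric_graph M \<and> connected_space (graph_topology M)"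

definition subgraph :: "'a model \<Rightarrow> 'a model \<Rightarrow> bool" where
  "subgraph H M \<longleftrightarrow> metric_graph H \<and> metric_graph M \<and> verts H \<subseteq> verts M \<and> edges H \<subseteq> edges M \<and>
     (\<forall>e\<in>edges H. len H e = len M e \<and> chart H e = chart M e)"

definition joins :: "'a model \<Rightarrow> 'a set \<Rightarrow> 'a \<Rightarrow> 'a \<Rightarrow> bool" where
  "joins M e u w \<longleftrightarrow> bounded_edge M e \<and> {src M e, tgt M e} = {u, w}"

definition is_loop :: "'a model \<Rightarrow> 'a set \<Rightarrow> bool" where
  "is_loop M e \<longleftrightarrow> bounded_edge M e \<and> src M e = tgt M e"

definition edges_at :: "'a model \<Rightarrow> 'a \<Rightarrow> 'a set set" where
  "edges_at M v = {e \<in> edges M. src M e = v \<or> (bounded_edge M e \<and> tgt M e = v)}"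

text \<open>The outgoing edges at a vertex; a loop leaves it twice.\<close>

definition directions :: "'a model \<Rightarrow> 'a \<Rightarrow> ('a set \<times> bool) set" where
  "directions M v = {(e, False) | e. e \<in> edges M \<and> src M e = v} \<union>
                    {(e, True) | e. bounded_edge M e \<and> tgt M e = v}"

definition valence :: "'a model \<Rightarrow> 'a \<Rightarrow> nat" where
  "valence M v = card (directions M v)"

text \<open>A cycle may have length 1 (a loop) or 2 (a pair of parallel edges).\<close>

definition has_cycle :: "'a model \<Rightarrow> bool" where
  "has_cycle M \<longleftrightarrow> (\<exists>vs es. es \<noteq> [] \<and> length vs = length es \<and> distinct vs \<and> distinct es \<and>
     (\<forall>i<length es. joins M (es ! i) (vs ! i) (vs ! (Suc i mod length es))))"

definition metric_tree :: "'a model \<Rightarrow> bool" where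
  "metric_tree M \<longleftrightarrow> connected_graph M \<and> \<not> has_cycle M"

definition metric_path :: "'a model \<Rightarrow> bool" where
  "metric_path P \<longleftrightarrow> metric_tree P \<and>
     (\<exists>I :: real set. is_interval I \<and> graph_topology P homeomorphic_space top_of_set I)"

section \<open>Tropical curves, canonical models and modifications\<close>

text \<open>
  The genus function is part of a tropical curve, but shrinking, patterns (which ask for genuine
  cycles) and covers do not involve it.
\<close>

definition tropical_curve :: "'a model \<Rightarrow> ('a \<Rightarrow> nat) \<Rightarrow> bool" where
  "tropical_curve M g \<longleftrightarrow> connected_graph M \<and> finite {x \<in> points M. g x \<noteq> 0}"

inductive shrink :: "'a model \<Rightarrow> 'a model \<Rightarrow> bool" where
  unbounded: "e \<in> edges M \<Longrightarrow> len M e = \<infinity> \<Longrightarrow> shrink M (M\<lparr>edges := edges M - {e}\<rparr>)"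
| leaf: "v \<in> verts M \<Longrightarrow> valence M v = 1 \<Longrightarrow> bounded_edge M e \<Longrightarrow> e \<in> edges_at M v \<Longrightarrow>
    shrink M (M\<lparr>verts := verts M - {v}, edges := edges M - {e}\<rparr>)"

definition canonical_model :: "'a model \<Rightarrow> 'a model \<Rightarrow> bool" where
  "canonical_model M C \<longleftrightarrow>
     (\<exists>K. shrink\<^sup>*\<^sup>* M K \<and> (\<forall>N. \<not> shrink K N) \<and> model_of C K)"

definition crowded_graph :: "'a model \<Rightarrow> bool" where
  "crowded_graph C \<longleftrightarrow> metric_graph C \<and>
     (\<exists>v1 v2. \<exists>H :: nat \<Rightarrow> 'a model. \<exists>e e' :: nat \<Rightarrow> 'a set.
        v1 \<noteq> v2 \<and> valence C v1 = 3 \<and> valence C v2 = 3 \<and>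
        (\<forall>i\<in>{1,2,3}. subgraph (H i) C \<and> connected_graph (H i) \<and> has_cycle (H i) \<and>
            v1 \<notin> verts (H i) \<and> v2 \<notin> verts (H i)) \<and>
        (\<forall>i\<in>{1,2,3}. \<forall>j\<in>{1,2,3}. i \<noteq> j \<longrightarrow> disjnt (verts (H i)) (verts (H j))) \<and>
        (\<forall>i\<in>{1,2,3}. (\<exists>w\<in>verts (H i). joins C (e i) v1 w) \<and>
                        (\<exists>w\<in>verts (H i). joins C (e' i) v2 w)) \<and>
        verts C = {v1, v2} \<union> (\<Union>i\<in>{1,2,3}. verts (H i)) \<and>
        edges C = (\<Union>i\<in>{1,2,3}. edges (H i)) \<union> e ` {1,2,3} \<union> e' ` {1,2,3})"

definition has_crowded_pattern :: "'a model \<Rightarrow> bool" where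
  "has_crowded_pattern M \<longleftrightarrow> (\<exists>C. canonical_model M C \<and> crowded_graph C)"

text \<open>
  \<open>M'\<close> is obtained from \<open>M\<close> by gluing finitely many trees, each meeting \<open>M\<close> in a single point. The
  points of \<open>M\<close> are kept as points of \<open>M'\<close>. If \<open>M\<close> has a cycle, gluing trees does not change the
  canonical model, so that requirement needs no separate clause. The empty family of trees gives \<open>M\<close> itself.
\<close>

definition tropical_modification :: "'a model \<Rightarrow> 'a model \<Rightarrow> bool" where
  "tropical_modification M M' \<longleftrightarrow>
     (\<exists>N N'. \<exists>Ts :: 'a model set. model_of N M \<and> model_of N' M' \<and> subgraph N N' \<and> finite Ts \<and>
        (\<forall>T\<in>Ts. subgraph T N' \<and> metric_tree T \<and> disjnt (edges T) (edges N) \<and>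
            (\<exists>p. verts T \<inter> verts N = {p})) \<and>
        (\<forall>T\<in>Ts. \<forall>T'\<in>Ts. T \<noteq> T' \<longrightarrow>
            disjnt (edges T) (edges T') \<and> verts T \<inter> verts T' \<subseteq> verts N) \<and>
        verts N' = verts N \<union> (\<Union>T\<in>Ts. verts T) \<and>
        edges N' = edges N \<union> (\<Union>T\<in>Ts. edges T))"

section \<open>Tropical covers\<close>

text \<open>
  For a bounded edge the stretching factor is the ratio of lengths; an unbounded edge has to be
  mapped linearly onto an unbounded edge, and the factor is the slope. The factor is used only for
  edges that are mapped onto edges.
\<close>

definition has_stretch :: "'a model \<Rightarrow> 'b model \<Rightarrow> ('a \<Rightarrow> 'b) \<Rightarrow> 'a set \<Rightarrow> nat \<Rightarrow> bool" where
  "has_stretch M N \<phi> e k \<longleftrightarrow>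
     (if len M e < \<infinity> then len N (\<phi> ` e) / len M e = ereal (real k)
      else len N (\<phi> ` e) = \<infinity> \<and>
        (\<forall>t\<in>open_dom M e. \<phi> (chart M e t) = chart N (\<phi> ` e) (real k * t)))"

definition stretch :: "'a model \<Rightarrow> 'b model \<Rightarrow> ('a \<Rightarrow> 'b) \<Rightarrow> 'a set \<Rightarrow> nat" where
  "stretch M N \<phi> e = (if \<phi> ` e \<in> edges N then (THE k. has_stretch M N \<phi> e k) else 0)"

text \<open>
  The conditions on a continuous map relative to fixed models of source and target. A morphism of
  metric graphs is a map satisfying them for suitable models.
\<close>

definition model_morphism :: "'a model \<Rightarrow> 'b model \<Rightarrow> ('a \<Rightarrow> 'b) \<Rightarrow> bool" where
  "model_morphism M N \<phi> \<longleftrightarrow> metric_graph M \<and> metric_graph N \<and>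
     continuous_map (graph_topology M) (graph_topology N) \<phi> \<and>
     \<phi> ` verts M \<subseteq> verts N \<and>
     (\<forall>e\<in>edges M. (\<phi> ` e \<in> edges N \<and> (\<exists>k>0. has_stretch M N \<phi> e k)) \<or>
        (\<exists>v\<in>verts N. \<phi> ` e = {v}))"

definition nondegenerate :: "'a model \<Rightarrow> 'b model \<Rightarrow> ('a \<Rightarrow> 'b) \<Rightarrow> bool" where
  "nondegenerate M N \<phi> \<longleftrightarrow>
     (\<forall>v\<in>verts M. \<exists>e\<in>edges_at M v. stretch M N \<phi> e > 0) \<and>
     (\<forall>e. is_loop M e \<longrightarrow> \<phi> ` e \<in> edges N)"

definition mult_along :: "'a model \<Rightarrow> 'b model \<Rightarrow> ('a \<Rightarrow> 'b) \<Rightarrow> 'a \<Rightarrow> 'b set \<Rightarrow> nat" where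
  "mult_along M N \<phi> v e' = (\<Sum>e | e \<in> edges_at M v \<and> \<phi> ` e = e'. stretch M N \<phi> e)"

definition harmonic :: "'a model \<Rightarrow> 'b model \<Rightarrow> ('a \<Rightarrow> 'b) \<Rightarrow> bool" where
  "harmonic M N \<phi> \<longleftrightarrow> (\<forall>v\<in>verts M. \<forall>e'\<in>edges_at N (\<phi> v). \<forall>e''\<in>edges_at N (\<phi> v).
     mult_along M N \<phi> v e' = mult_along M N \<phi> v e'')"

definition has_degree :: "'a model \<Rightarrow> 'b model \<Rightarrow> ('a \<Rightarrow> 'b) \<Rightarrow> nat \<Rightarrow> bool" where
  "has_degree M N \<phi> d \<longleftrightarrow>
     (\<forall>e'\<in>edges N. (\<Sum>e | e \<in> edges M \<and> \<phi> ` e = e'. stretch M N \<phi> e) = d)"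

definition mult :: "'a model \<Rightarrow> 'b model \<Rightarrow> ('a \<Rightarrow> 'b) \<Rightarrow> 'a \<Rightarrow> nat" where
  "mult M N \<phi> v = mult_along M N \<phi> v (SOME e'. e' \<in> edges_at N (\<phi> v))"

definition riemann_hurwitz :: "'a model \<Rightarrow> 'b model \<Rightarrow> ('a \<Rightarrow> 'b) \<Rightarrow> bool" where
  "riemann_hurwitz M N \<phi> \<longleftrightarrow> (\<forall>v\<in>verts M. valence N (\<phi> v) \<ge> 2 \<longrightarrow>
     (2 * int (mult M N \<phi> v) - 2) -
       (\<Sum>(e, b)\<in>directions M v. int (stretch M N \<phi> e) - 1) \<ge> 0)"

definition tropical_cover :: "'a model \<Rightarrow> 'b model \<Rightarrow> ('a \<Rightarrow> 'b) \<Rightarrow> nat \<Rightarrow> bool" where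
  "tropical_cover M N \<phi> d \<longleftrightarrow> model_morphism M N \<phi> \<and> harmonic M N \<phi> \<and> has_degree M N \<phi> d \<and>
     riemann_hurwitz M N \<phi>"

definition well_contracted_cover :: "'a model \<Rightarrow> 'b model \<Rightarrow> ('a \<Rightarrow> 'b) \<Rightarrow> nat \<Rightarrow> bool" where
  "well_contracted_cover G P \<phi> d \<longleftrightarrow> metric_path P \<and>
     (\<exists>M N. model_of M G \<and> model_of N P \<and> tropical_cover M N \<phi> d \<and> nondegenerate M N \<phi>)"

end

theory Submission
  imports Defs
begin

text \<open>
  Write \<open>X\<close> for the space of \<open>\<Gamma>'\<close>, let \<open>\<phi>\<close> be a
  cover of degree 3 of a path, and place the path in the real line by a coordinate \<open>h\<close>.
  The total multiplicity of the vertices in every fibre over a vertex of the path is 3.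

  All that is used of the pattern is topological and survives gluing trees: the points
  \<open>v1\<close> and \<open>v2\<close> cut \<open>X\<close> into three open parts
  \<open>U i\<close>; each part contains a connected set \<open>W i\<close> that accumulates at both
  \<open>v1\<close> and \<open>v2\<close>; and each \<open>W i\<close> contains a circle
  \<open>S i\<close> (\<open>crowded_pattern_modification\<close>). A circle is remembered only as
  an infinite set that no point disconnects. Such a set is a union of closed bounded edges in every
  model, with at least two directions at each vertex (\<open>edge_subset\<close>,
  \<open>two_edges_at_vertex\<close>), so no common refinement of the models of
  \<open>\<Gamma>'\<close> has to be built.

  Two facts about multiplicities carry the argument. First, a circle takes multiplicity at least 2
  from every vertex fibre it meets (\<open>circle_fibre\<close>): if it meets the fibre in a single
  vertex \<open>u\<close>, then without \<open>u\<close> it is still connected, hence stays on one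
  side, so two of its edges at \<open>u\<close> lie over the same edge of the path. Second, the
  multiplicity that \<open>U i\<close> takes from the fibre over \<open>y\<close> does not change
  while \<open>y\<close> moves along a segment that avoids \<open>\<phi> v1\<close> and
  \<open>\<phi> v2\<close> (\<open>degree_over_between\<close>), because away from \<open>v1\<close>
  and \<open>v2\<close> the part \<open>U i\<close> is open and closed.

  The points \<open>v1\<close> and \<open>v2\<close> are vertices in every model, because three
  parts accumulate at them (\<open>branch_point_vertex\<close>). Choose a vertex in each circle. The
  images are distinct, since 2 + 2 exceeds 3. Let \<open>a\<close>, \<open>b\<close>,
  \<open>c\<close> be their images in the order of the path, belonging to the parts
  \<open>i\<close>, \<open>j\<close>, \<open>l\<close>. Over \<open>b\<close> the part
  \<open>U j\<close> takes 2, so there is at most one vertex over \<open>b\<close> outside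
  \<open>U j\<close>; it misses \<open>U i\<close> or \<open>U l\<close>, say \<open>U i\<close>.
  Then the image of the connected set \<open>W i\<close> misses \<open>b\<close> and lies strictly
  to its left, so \<open>\<phi> v1\<close> and \<open>\<phi> v2\<close> are at or to the left of
  \<open>b\<close>. If both lie strictly to the left, the multiplicity of \<open>U l\<close> is
  constant from \<open>b\<close> to \<open>c\<close>, hence at least 2 over \<open>b\<close> as
  well, which again gives 2 + 2. If one of them lies over \<open>b\<close>, it is the exceptional
  vertex, so \<open>U l\<close> misses the fibre too; then \<open>\<phi> v1\<close> and
  \<open>\<phi> v2\<close> are also at or to the right of \<open>b\<close>, so both equal
  \<open>b\<close>, and \<open>v1\<close> and \<open>v2\<close> are two exceptional vertices.
\<close>

section \<open>The topology of a graph\<close>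

text \<open>
  The end vertices of an edge, without a case distinction between bounded and unbounded edges.
\<close>
definition ends :: "'a model \<Rightarrow> 'a set \<Rightarrow> 'a set" where
  "ends M e = chart M e ` (closed_dom M e - open_dom M e)"

lemma closed_closed_dom: "closed (closed_dom M e)"
proof (cases "len M e")
  case (real l)
  then have "closed_dom M e = {0..l}" by (auto simp: closed_dom_def)
  then show ?thesis by simp
next
  case PInf
  then have "closed_dom M e = {0..}" by (auto simp: closed_dom_def)
  then show ?thesis by simp
next
  case MInf
  then have "closed_dom M e = {}" by (auto simp: closed_dom_def)
  then show ?thesis by simp
qed

lemma open_open_dom: "open (open_dom M e)"
proof (cases "len M e")
  case (real l)
  then have "open_dom M e = {0<..<l}" by (auto simp: open_dom_def)
  then show ?thesis by simp
next
  case PInf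
  then have "open_dom M e = {0<..}" by (auto simp: open_dom_def)
  then show ?thesis by simp
next
  case MInf
  then have "open_dom M e = {}" by (auto simp: open_dom_def)
  then show ?thesis by simp
qed

lemma open_dom_is_interval: "is_interval (open_dom M e)"
  unfolding is_interval_1 open_dom_def
  by (auto intro: le_less_trans ereal_less_eq(3)[THEN iffD2] less_le_trans)

lemma open_dom_subset: "open_dom M e \<subseteq> closed_dom M e"
  by (auto simp: open_dom_def closed_dom_def)

lemma finite_dom_boundary: "finite (closed_dom M e - open_dom M e)"
proof -
  have "closed_dom M e - open_dom M e \<subseteq> {0, real_of_ereal (len M e)}"
    by (cases "len M e") (auto simp: closed_dom_def open_dom_def)
  then show ?thesis by (rule finite_subset) simp
qed

context
  fixes M :: "'a model"
  assumes mg: "metric_graph M"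
begin

lemma len_pos: "e \<in> edges M \<Longrightarrow> 0 < len M e"
  using mg by (auto simp: metric_graph_def)

lemma ends_eq:
  assumes "e \<in> edges M"
  shows "ends M e = insert (src M e) (if bounded_edge M e then {tgt M e} else {})"
proof -
  have "closed_dom M e - open_dom M e
      = insert 0 (if bounded_edge M e then {real_of_ereal (len M e)} else {})"
    using len_pos[OF assms] assms
    by (cases "len M e") (auto simp: closed_dom_def open_dom_def bounded_edge_def)
  then show ?thesis by (auto simp: ends_def src_def tgt_def)
qed

lemma edges_at_iff: "e \<in> edges_at M u \<longleftrightarrow> e \<in> edges M \<and> u \<in> ends M e"
  by (auto simp: edges_at_def ends_eq bounded_edge_def split: if_splits)

lemma ends_in_verts: "e \<in> edges M \<Longrightarrow> ends M e \<subseteq> verts M"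
  using mg by (auto simp: ends_eq metric_graph_def)

lemma src_in_ends: "e \<in> edges M \<Longrightarrow> src M e \<in> ends M e"
  by (auto simp: ends_eq)

lemma edge_chart: "e \<in> edges M \<Longrightarrow> chart M e ` open_dom M e = e"
  using mg by (auto simp: metric_graph_def bij_betw_def)

lemma chart_inj: "e \<in> edges M \<Longrightarrow> inj_on (chart M e) (open_dom M e)"
  using mg by (auto simp: metric_graph_def bij_betw_def)

lemma chart_open_in: "e \<in> edges M \<Longrightarrow> t \<in> open_dom M e \<Longrightarrow> chart M e t \<in> e"
  using edge_chart by blast

lemma chart_end: "t \<in> closed_dom M e \<Longrightarrow> t \<notin> open_dom M e \<Longrightarrow> chart M e t \<in> ends M e"
  by (auto simp: ends_def)

lemma chart_closed_image: "e \<in> edges M \<Longrightarrow> chart M e ` closed_dom M e = e \<union> ends M e"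
  using edge_chart[of e] open_dom_subset[of M e] by (auto simp: ends_def) 

lemma edge_verts_disjoint: "e \<in> edges M \<Longrightarrow> x \<in> e \<Longrightarrow> x \<notin> verts M"
  using mg by (auto simp: metric_graph_def disjnt_def)

lemma edge_unique: "e \<in> edges M \<Longrightarrow> f \<in> edges M \<Longrightarrow> x \<in> e \<Longrightarrow> x \<in> f \<Longrightarrow> e = f"
  using mg by (auto simp: metric_graph_def pairwise_def disjnt_def)

text \<open>
  A point of a closed edge that lies in some open edge lies in its own: the charts send boundary
  parameters to vertices.
\<close>
lemma chart_in_edge_iff:
  assumes "e \<in> edges M" "f \<in> edges M" "t \<in> closed_dom M f"
  shows "chart M f t \<in> e \<longleftrightarrow> f = e \<and> t \<in> open_dom M f"
  using assms chart_open_in chart_end ends_in_verts edge_unique edge_verts_disjoint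
  by (metis in_mono)

lemma chart_in_points: "e \<in> edges M \<Longrightarrow> t \<in> closed_dom M e \<Longrightarrow> chart M e t \<in> points M"
  using chart_closed_image[of e] ends_in_verts[of e] by (auto simp: points_def)

lemma infinite_edge: "e \<in> edges M \<Longrightarrow> infinite e"
proof -
  assume e: "e \<in> edges M"
  obtain l where l: "0 < l" "ereal l < len M e" 
    using ereal_dense2[of 0 "len M e"] len_pos[OF e] by (auto simp: zero_ereal_def)
  then have "{0<..<l} \<subseteq> open_dom M e"
    by (auto simp: open_dom_def intro: less_trans[of _ "ereal l"])
  moreover have "infinite {0<..<l}" using l by simp
  ultimately have "infinite (open_dom M e)" using finite_subset by blast
  then show ?thesis using edge_chart[OF e] chart_inj[OF e] by (metis finite_image_iff)
qed

lemma topspace_graph: "topspace (graph_topology M) = points M"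
proof -
  have "openin (graph_topology M) (points M)"
    unfolding openin_graph_topology
  proof (intro conjI ballI)
    fix e assume "e \<in> edges M"
    then have "{t \<in> closed_dom M e. chart M e t \<in> points M} = closed_dom M e"
      using chart_in_points by auto
    then show "openin (top_of_set (closed_dom M e)) {t \<in> closed_dom M e. chart M e t \<in> points M}"
      by simp
  qed simp
  then show ?thesis
    by (metis openin_graph_topology openin_subset openin_topspace subset_antisym)
qed

lemma chart_continuous:
  assumes "e \<in> edges M"
  shows "continuous_map (top_of_set (closed_dom M e)) (graph_topology M) (chart M e)"
  using assms chart_in_points
  by (auto simp: continuous_map_def topspace_graph openin_graph_topology)

lemma closedin_graph_topology:
  "closedin (graph_topology M) Z \<longleftrightarrow>
     Z \<subseteq> points M \<and> (\<forall>e\<in>edges M. closed {t \<in> closed_dom M e. chart M e t \<in> Z})"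
proof -
  have "openin (top_of_set (closed_dom M e)) {t \<in> closed_dom M e. chart M e t \<in> points M - Z}
    \<longleftrightarrow> closed {t \<in> closed_dom M e. chart M e t \<in> Z}" if "e \<in> edges M" for e
  proof -
    have "{t \<in> closed_dom M e. chart M e t \<in> points M - Z}
        = closed_dom M e - {t \<in> closed_dom M e. chart M e t \<in> Z}"
      using chart_in_points that by auto
    moreover have "{t \<in> closed_dom M e. chart M e t \<in> Z} \<subseteq> closed_dom M e" by auto
    ultimately have "openin (top_of_set (closed_dom M e)) {t \<in> closed_dom M e. chart M e t \<in> points M - Z}
      \<longleftrightarrow> closedin (top_of_set (closed_dom M e)) {t \<in> closed_dom M e. chart M e t \<in> Z}"
      by (simp add: closedin_def)
    then show ?thesis by (simp add: closedin_closed_eq closed_closed_dom)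
  qed
  then show ?thesis
    by (auto simp: closedin_def topspace_graph openin_graph_topology)
qed

text \<open>
  In other closed edges, and at the ends of its own, an arc can only pick up end points. So the
  preimages in the charts are closed up to finitely many parameters.
\<close>
lemma closed_arc:
  assumes e: "e \<in> edges M" and Z: "closed Z" "Z \<subseteq> closed_dom M e"
  shows "closedin (graph_topology M) (chart M e ` Z)"
  unfolding closedin_graph_topology
proof (intro conjI ballI)
  show "chart M e ` Z \<subseteq> points M" using chart_in_points e Z by auto
  fix f assume f: "f \<in> edges M"
  define A where "A = {t \<in> closed_dom M f. chart M f t \<in> chart M e ` Z}"
  define Z' where "Z' = (if f = e then Z else {})"
  have "A - Z' \<subseteq> closed_dom M f - open_dom M f"
  proof
    fix t assume t: "t \<in> A - Z'"
    then obtain z where z: "z \<in> Z" "chart M f t = chart M e z" by (auto simp: A_def)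
    show "t \<in> closed_dom M f - open_dom M f"
    proof (rule ccontr)
      assume "\<not> ?thesis"
      then have to: "t \<in> open_dom M f" using t by (auto simp: A_def)
      then have "chart M e z \<in> f" using chart_open_in[OF f to] z by simp
      then have "e = f" "z \<in> open_dom M e" using chart_in_edge_iff[OF f e] z Z by auto
      then have "t = z" using chart_inj[OF f] to z by (metis inj_onD)
      then show False using t z \<open>e = f\<close> by (auto simp: Z'_def A_def)
    qed
  qed
  then have "finite (A - Z')" using finite_dom_boundary finite_subset by blast
  moreover have "Z' \<subseteq> A" using Z by (auto simp: Z'_def A_def)
  then have eq: "A = Z' \<union> (A - Z')" by auto
  moreover have "closed Z'" using Z by (auto simp: Z'_def)
  ultimately have "closed (Z' \<union> (A - Z'))"
    using closed_Un[OF _ finite_imp_closed, of Z' "A - Z'"] by metis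
  with eq have "closed A" by metis
  then show "closed {t \<in> closed_dom M f. chart M f t \<in> chart M e ` Z}" by (simp add: A_def)
qed

lemma open_arc:
  assumes e: "e \<in> edges M" and Z: "open Z" "Z \<subseteq> open_dom M e"
  shows "openin (graph_topology M) (chart M e ` Z)"
  unfolding openin_graph_topology
proof (intro conjI ballI)
  have Z': "Z \<subseteq> closed_dom M e" using Z open_dom_subset[of M e] by auto
  show "chart M e ` Z \<subseteq> points M" using chart_in_points e Z' by auto
  fix f assume f: "f \<in> edges M"
  have eq: "{t \<in> closed_dom M f. chart M f t \<in> chart M e ` Z} = (if f = e then Z else {})"
  proof -
    have "f = e \<and> t \<in> Z" if t: "t \<in> closed_dom M f" "z \<in> Z" "chart M f t = chart M e z" for t z
    proof -
      have z: "z \<in> open_dom M e" using that Z by auto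
      then have "chart M f t \<in> e" using t chart_open_in[OF e] by simp
      then have "f = e" "t \<in> open_dom M e" using chart_in_edge_iff[OF e f t(1)] by auto
      then show ?thesis using t z chart_inj[OF e] by (metis inj_onD)
    qed
    then show ?thesis using Z' by auto
  qed
  have "openin (top_of_set (closed_dom M e)) Z"
    using Z Z' by (metis open_subset)
  then show "openin (top_of_set (closed_dom M f)) {t \<in> closed_dom M f. chart M f t \<in> chart M e ` Z}"
    unfolding eq by auto
qed

lemma openin_edge: "e \<in> edges M \<Longrightarrow> openin (graph_topology M) e"
  using open_arc[of e "open_dom M e"] by (simp add: open_open_dom edge_chart)

lemma closedin_closed_edge: "e \<in> edges M \<Longrightarrow> closedin (graph_topology M) (e \<union> ends M e)"
  using closed_arc[of e "closed_dom M e"] by (simp add: closed_closed_dom chart_closed_image)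

lemma connectedin_arc:
  assumes "e \<in> edges M" "is_interval Z" "Z \<subseteq> closed_dom M e"
  shows "connectedin (graph_topology M) (chart M e ` Z)"
proof -
  have "connectedin (top_of_set (closed_dom M e)) Z"
    using assms by (simp add: connectedin_subtopology is_interval_connected)
  then show ?thesis using connectedin_continuous_map_image[OF chart_continuous] assms by blast
qed

lemma connectedin_edge: "e \<in> edges M \<Longrightarrow> connectedin (graph_topology M) e"
  using connectedin_arc[of e "open_dom M e"] by (simp add: edge_chart open_dom_is_interval open_dom_subset)

lemma open_dom_dense:
  assumes "e \<in> edges M" shows "closed_dom M e \<subseteq> closure (open_dom M e)"
proof (cases "len M e")
  case (real l)
  then have "closed_dom M e = {0..l}" "open_dom M e = {0<..<l}" "0 < l"
    using len_pos[OF assms] by (auto simp: closed_dom_def open_dom_def)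
  then show ?thesis by simp
next
  case PInf
  then have "closed_dom M e = {0..}" "open_dom M e = {0<..}"
    by (auto simp: closed_dom_def open_dom_def)
  then show ?thesis by simp
next
  case MInf
  then show ?thesis using len_pos[OF assms] by auto
qed

lemma ends_in_closure:
  assumes e: "e \<in> edges M"
  shows "e \<union> ends M e \<subseteq> graph_topology M closure_of e"
proof -
  have "top_of_set (closed_dom M e) closure_of open_dom M e = closed_dom M e"
    using open_dom_dense[OF e] open_dom_subset[of M e]
    by (simp add: closure_of_subtopology Int_absorb1 Int_absorb2)
  then have "chart M e ` closed_dom M e \<subseteq> graph_topology M closure_of (chart M e ` open_dom M e)"
    using chart_continuous[OF e] by (metis continuous_map_image_closure_subset)
  then show ?thesis by (simp add: chart_closed_image[OF e] edge_chart[OF e])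
qed

lemma connectedin_edge_with_ends:
  assumes "e \<in> edges M" "e \<subseteq> A" "A \<subseteq> e \<union> ends M e"
  shows "connectedin (graph_topology M) A"
  using connectedin_intermediate_closure_of[OF connectedin_edge[OF assms(1)] assms(2)]
    ends_in_closure[OF assms(1)] assms by blast

text \<open>
  In the chart of an edge at \<open>u\<close> the star omits at most the far end, which is a finite
  and hence closed set of parameters.
\<close>
lemma openin_star:
  assumes "u \<in> verts M"
  shows "openin (graph_topology M) (insert u (\<Union>(edges_at M u)))"
  unfolding openin_graph_topology
proof (intro conjI ballI)
  show "insert u (\<Union>(edges_at M u)) \<subseteq> points M"
    using assms by (auto simp: points_def edges_at_iff)
  fix f assume f: "f \<in> edges M"
  let ?A = "{t \<in> closed_dom M f. chart M f t \<in> insert u (\<Union>(edges_at M u))}"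
  let ?B = "closed_dom M f - {t \<in> closed_dom M f - open_dom M f. chart M f t \<noteq> u}"
  show "openin (top_of_set (closed_dom M f)) ?A"
  proof (cases "f \<in> edges_at M u")
    case True
    have "?A = ?B"
      using True chart_open_in[OF f] chart_in_edge_iff[OF _ f] 
      by (auto simp: edges_at_iff)
    moreover have "closed {t \<in> closed_dom M f - open_dom M f. chart M f t \<noteq> u}"
      by (intro finite_imp_closed finite_subset[OF _ finite_dom_boundary[of M f]]) auto
    then have "closedin (top_of_set (closed_dom M f)) {t \<in> closed_dom M f - open_dom M f. chart M f t \<noteq> u}"
      by (rule closed_subset[rotated]) auto
    then have "openin (top_of_set (closed_dom M f)) ?B"
      by (rule openin_diff[OF openin_subtopology_self])
    ultimately show ?thesis by (simp only:)
  next
    case False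
    have "?A = {}"
    proof -
      have "chart M f t \<noteq> u \<and> chart M f t \<notin> \<Union>(edges_at M u)" if t: "t \<in> closed_dom M f" for t
        using False f t chart_end[OF t] chart_open_in[OF f] chart_in_edge_iff[OF _ f t] 
            edge_verts_disjoint[OF f] assms
        by (auto simp: edges_at_iff)
      then show ?thesis by blast
    qed
    then show ?thesis by (simp only: openin_empty)
  qed
qed

lemma closedin_singleton:
  assumes "p \<in> points M"
  shows "closedin (graph_topology M) {p}"
  unfolding closedin_graph_topology
proof (intro conjI ballI)
  show "{p} \<subseteq> points M" using assms by simp
  fix e assume e: "e \<in> edges M"
  have "\<exists>a. {t \<in> closed_dom M e. chart M e t \<in> {p}} \<subseteq> insert a (closed_dom M e - open_dom M e)"
    using chart_inj[OF e] by (auto simp: inj_on_def)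
  then show "closed {t \<in> closed_dom M e. chart M e t \<in> {p}}"
    using finite_dom_boundary by (meson finite_imp_closed finite_insert finite_subset)
qed

end

section \<open>Models of one metric graph have one topology\<close>

text \<open>
  For the hard direction, closed sets are pushed forward. The finitely many segments coming from
  \<open>R\<close> form a closed subset of each closed edge of \<open>M\<close>, and this subset
  misses at most the parameters of vertices of \<open>R\<close>, which are finite in number; a
  nonempty open set of reals is infinite, so nothing is missed.
\<close>
lemma refines_same_topology:
  assumes "refines R M"
  shows "graph_topology R = graph_topology M"
proof -
  have R: "metric_graph R" and M: "metric_graph M" and pts: "points R = points M"
    using assms by (auto simp: refines_def)
  have "\<forall>e\<in>edges R. \<exists>f a s. f \<in> edges M \<and> (s = 1 \<or> s = -1) \<and> (\<forall>t\<in>closed_dom R e.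
        a + s * t \<in> closed_dom M f \<and> chart R e t = chart M f (a + s * t))"
    using assms by (fastforce simp: refines_def)
  then obtain F a s where F: "\<And>e. e \<in> edges R \<Longrightarrow> F e \<in> edges M"
    and s: "\<And>e. e \<in> edges R \<Longrightarrow> s e = 1 \<or> s e = -1"
    and dom: "\<And>e t. e \<in> edges R \<Longrightarrow> t \<in> closed_dom R e \<Longrightarrow> a e + s e * t \<in> closed_dom M (F e)"
    and ch: "\<And>e t. e \<in> edges R \<Longrightarrow> t \<in> closed_dom R e \<Longrightarrow> chart R e t = chart M (F e) (a e + s e * t)"
    by metis
  define g where "g e t = a e + s e * t" for e and t :: real
  define h where "h e t = s e * (t - a e)" for e and t :: real
  have gh: "g e (h e t) = t" "h e (g e t) = t" if "e \<in> edges R" for e t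
    using s[OF that] by (auto simp: g_def h_def)
  have g_cont: "continuous_on A (g e)" and h_cont: "continuous_on A (h e)" for A e
    unfolding g_def h_def by (intro continuous_intros)+
  have to_R: "openin (graph_topology R) U" if U: "openin (graph_topology M) U" for U
    unfolding openin_graph_topology
  proof (intro conjI ballI)
    show "U \<subseteq> points R" using U pts by (simp add: openin_graph_topology)
    fix e assume e: "e \<in> edges R"
    let ?V = "{t \<in> closed_dom M (F e). chart M (F e) t \<in> U}"
    have eq: "{t \<in> closed_dom R e. chart R e t \<in> U} = closed_dom R e \<inter> g e -` ?V"
      using dom[OF e] ch[OF e] by (auto simp: g_def)
    have "openin (top_of_set (closed_dom M (F e))) ?V"
      using U F[OF e] by (simp add: openin_graph_topology)
    moreover have "g e \<in> closed_dom R e \<rightarrow> closed_dom M (F e)"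
      using dom[OF e] by (auto simp: g_def)
    ultimately have "openin (top_of_set (closed_dom R e)) (closed_dom R e \<inter> g e -` ?V)"
      using continuous_openin_preimage[OF g_cont] by blast
    then show "openin (top_of_set (closed_dom R e)) {t \<in> closed_dom R e. chart R e t \<in> U}"
      using eq by metis
  qed
  have image_closed: "closed (g e ` A)" if "e \<in> edges R" "closed A" for e A
  proof -
    have "g e ` A = h e -` A"
      using gh[OF that(1)] by (auto simp: image_iff) metis
    then show ?thesis using closed_vimage[OF that(2) h_cont[of UNIV e]] by simp
  qed
  have fin: "finite {e \<in> edges R. F e = f}" for f
    using R by (auto simp: metric_graph_def)
  have cover: "closed_dom M f \<subseteq> (\<Union>e\<in>{e \<in> edges R. F e = f}. g e ` closed_dom R e)"
    if f: "f \<in> edges M" for f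
  proof -
    define J where "J = (\<Union>e\<in>{e \<in> edges R. F e = f}. g e ` closed_dom R e)"
    have J: "closed J" unfolding J_def
      by (intro closed_UN fin) (auto intro: image_closed closed_closed_dom)
    have "t \<in> J" if t: "t \<in> open_dom M f" "chart M f t \<notin> verts R" for t
    proof -
      have "chart M f t \<in> points R"
        using chart_in_points[OF M f] t open_dom_subset[of M f] pts by auto
      then obtain e where e: "e \<in> edges R" "chart M f t \<in> e"
        using t by (auto simp: points_def)
      then obtain r where r: "r \<in> open_dom R e" "chart R e r = chart M f t"
        using edge_chart[OF R e(1)] by (metis imageE)
      then have r': "r \<in> closed_dom R e" using open_dom_subset by auto
      then have eq: "chart M (F e) (g e r) = chart M f t" using ch[OF e(1)] r by (simp add: g_def)
      moreover have "chart M f t \<in> f" using chart_open_in[OF M f] t by auto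
      moreover have "g e r \<in> closed_dom M (F e)" using dom[OF e(1) r'] by (simp add: g_def)
      ultimately have "F e = f" "g e r \<in> open_dom M f"
        using chart_in_edge_iff[OF M f F[OF e(1)], of "g e r"] by auto
      then have "g e r = t" using eq t chart_inj[OF M f] by (simp add: inj_on_eq_iff)
      then show "t \<in> J" using e r' \<open>F e = f\<close> by (auto simp: J_def)
    qed
    then have "chart M f ` (open_dom M f - J) \<subseteq> verts R" by auto
    moreover have "finite (verts R)" using R by (simp add: metric_graph_def)
    moreover have "inj_on (chart M f) (open_dom M f - J)"
      using chart_inj[OF M f] by (rule inj_on_subset) auto
    ultimately have "finite (open_dom M f - J)" by (metis finite_imageD finite_subset)
    moreover have "open (open_dom M f - J)" using J open_open_dom by auto
    ultimately have "open_dom M f \<subseteq> J" using finite_imp_not_open by blast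
    then have "closure (open_dom M f) \<subseteq> J" using J by (simp add: closure_minimal)
    then show ?thesis using open_dom_dense[OF M f] by (auto simp: J_def)
  qed
  have to_M: "closedin (graph_topology M) Z" if Z: "closedin (graph_topology R) Z" for Z
    unfolding closedin_graph_topology[OF M]
  proof (intro conjI ballI)
    show "Z \<subseteq> points M" using Z pts by (simp add: closedin_graph_topology[OF R])
    fix f assume f: "f \<in> edges M"
    let ?E = "{e \<in> edges R. F e = f}"
    have "{t \<in> closed_dom M f. chart M f t \<in> Z}
        = (\<Union>e\<in>?E. g e ` {t \<in> closed_dom R e. chart R e t \<in> Z})" (is "?L = ?Q")
    proof
      show "?L \<subseteq> ?Q"
      proof
        fix t assume t: "t \<in> ?L"
        then obtain e r where e: "e \<in> edges R" "F e = f" and r: "r \<in> closed_dom R e" "t = g e r"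
          using cover[OF f] by blast
        then have "chart R e r \<in> Z" using t ch[OF e(1) r(1)] by (simp add: g_def)
        then have "t \<in> g e ` {t \<in> closed_dom R e. chart R e t \<in> Z}" using r by blast
        then show "t \<in> ?Q" using e by blast
      qed
      show "?Q \<subseteq> ?L" using dom ch by (auto simp: g_def)
    qed
    moreover have "closed ?Q"
      using Z by (intro closed_UN fin) (auto intro!: image_closed simp: closedin_graph_topology[OF R])
    ultimately show "closed ?L" by (rule ssubst)
  qed
  show ?thesis
  proof (rule topology_eq[THEN iffD2], intro allI iffI)
    fix U assume U: "openin (graph_topology R) U"
    then have "closedin (graph_topology R) (points R - U)"
      by (metis closedin_diff closedin_topspace topspace_graph[OF R])
    then have "closedin (graph_topology M) (points M - U)" using to_M pts by simp
    moreover have "U \<subseteq> points M" using openin_subset[OF U] by (simp add: topspace_graph[OF R] pts)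
    ultimately show "openin (graph_topology M) U"
      by (simp add: openin_closedin_eq topspace_graph[OF M])
  qed (rule to_R)
qed

lemma model_of_same_topology:
  assumes "model_of N M"
  shows "graph_topology N = graph_topology M" "points N = points M"
    "metric_graph N" "metric_graph M"
proof -
  obtain R where R: "refines R N" "refines R M" using assms by (auto simp: model_of_def)
  show "graph_topology N = graph_topology M" using R[THEN refines_same_topology] by simp
  show "points N = points M" "metric_graph N" "metric_graph M" using R by (simp_all add: refines_def)
qed

section \<open>Sets without cut points are subgraphs\<close>

text \<open>
  What remains of a circle when models are forgotten. Infinity excludes single points; taking
  \<open>p\<close> outside \<open>S\<close> shows that \<open>S\<close> itself is connected.
\<close>
definition without_cut_points :: "'a topology \<Rightarrow> 'a set \<Rightarrow> bool" where
  "without_cut_points T S \<longleftrightarrow> infinite S \<and> (\<forall>p. connectedin T (S - {p}))"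

text \<open>
  The open and the closed set have the same trace on \<open>S\<close>, which is therefore open and
  closed in \<open>S\<close>. In the applications they differ only in points outside
  \<open>S\<close>, typically the end points of an arc.
\<close>
lemma connectedin_open_closed:
  assumes "connectedin T S" "openin T A" "closedin T B" "S \<inter> A = S \<inter> B"
  shows "S \<inter> A = {} \<or> S \<subseteq> A"
proof -
  have "openin T (topspace T - B)" using assms by blast
  moreover have "S \<subseteq> A \<union> (topspace T - B)" "A \<inter> (topspace T - B) \<inter> S = {}"
    using assms connectedin_subset_topspace by blast+
  ultimately show ?thesis using connectedinD[OF assms(1,2)] assms(4) by blast
qed

lemma without_cut_points_connected:
  assumes "without_cut_points T S"
  shows "connectedin T S"
proof -
  obtain p q where pq: "p \<in> S" "q \<in> S" "p \<noteq> q"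
    using assms by (metis finite.emptyI finite.insertI finite_subset insertCI subsetI without_cut_points_def)
  have "infinite (S - {p,q})" using assms by (auto simp: without_cut_points_def)
  moreover have "(S - {p}) \<inter> (S - {q}) = S - {p,q}" by auto
  ultimately have "(S - {p}) \<inter> (S - {q}) \<noteq> {}" by (metis infinite_imp_nonempty)
  then have "connectedin T ((S - {p}) \<union> (S - {q}))"
    using assms by (intro connectedin_Un) (auto simp: without_cut_points_def)
  moreover have "(S - {p}) \<union> (S - {q}) = S" using pq by auto
  ultimately show ?thesis by simp
qed

context
  fixes M :: "'a model" and S :: "'a set"
  assumes mg: "metric_graph M" and S: "without_cut_points (graph_topology M) S"
begin

lemma subset_points: "S \<subseteq> points M"
  using connectedin_subset_topspace[OF without_cut_points_connected[OF S]]
  by (simp add: topspace_graph[OF mg])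

text \<open>
  Suppose that \<open>S\<close> misses the parameter \<open>t1\<close> but contains others on one
  side of it. Removing one of them, at \<open>t\<close>, separates the part of \<open>S\<close>
  between \<open>t\<close> and \<open>t1\<close> from the rest, so that part is empty or everything.
  It cannot be everything, as one sees by moving \<open>t\<close> towards \<open>t1\<close>. Hence
  there is only one such parameter, it is an isolated point of \<open>S\<close>, and connectedness
  fails.
\<close>
lemma gap_in_edge:
  assumes e: "e \<in> edges M" and t1: "t1 \<in> closed_dom M e" "chart M e t1 \<notin> S"
    and t0: "t0 \<in> open_dom M e" "t0 \<noteq> t1"
  shows "chart M e t0 \<notin> S"
proof
  assume t0S: "chart M e t0 \<in> S"
  define P where "P t \<longleftrightarrow> t \<in> open_dom M e \<and> chart M e t \<in> S \<and> (if t0 < t1 then t < t1 else t1 < t)" for t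
  define A where "A t = chart M e ` {min t t1<..<max t t1}" for t
  define B where "B t = chart M e ` {min t t1..max t t1}" for t
  have P0: "P t0" using t0 t0S by (auto simp: P_def)
  have between: "{min t t1<..<max t t1} \<subseteq> open_dom M e" "{min t t1..max t t1} \<subseteq> closed_dom M e"
    if "t \<in> open_dom M e" for t
    using that t1 unfolding open_dom_def closed_dom_def
    by (cases "len M e"; auto simp: min_def max_def split: if_splits)+
  have inA: "chart M e a \<in> A b \<longleftrightarrow> \<bar>a - t1\<bar> < \<bar>b - t1\<bar>" if "P a" "P b" for a b
  proof -
    have "chart M e a \<in> A b \<longleftrightarrow> a \<in> {min b t1<..<max b t1}"
      unfolding A_def using that between(1)[of b] inj_on_image_mem_iff[OF chart_inj[OF mg e]]
      by (auto simp: P_def)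
    also have "\<dots> \<longleftrightarrow> \<bar>a - t1\<bar> < \<bar>b - t1\<bar>"
      using that by (auto simp: P_def split: if_splits)
    finally show ?thesis .
  qed
  have dicho: "S \<inter> A t = {} \<or> S - {chart M e t} \<subseteq> A t" if t: "P t" for t
  proof -
    have "openin (graph_topology M) (A t)" "closedin (graph_topology M) (B t)"
      unfolding A_def B_def using between[of t] t
      by (auto intro!: open_arc[OF mg e] closed_arc[OF mg e] simp: P_def)
    moreover have "B t = insert (chart M e t) (insert (chart M e t1) (A t))"
    proof -
      have "{min t t1..max t t1} = insert t (insert t1 {min t t1<..<max t t1})" by auto
      then show ?thesis unfolding A_def B_def by (metis image_insert)
    qed
    then have "(S - {chart M e t}) \<inter> A t = (S - {chart M e t}) \<inter> B t"
      using t1 by auto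
    moreover have "connectedin (graph_topology M) (S - {chart M e t})"
      using S by (simp add: without_cut_points_def)
    moreover have "chart M e t \<notin> A t" using inA[OF t t] by simp
    ultimately show ?thesis using connectedin_open_closed by blast
  qed
  have claim1: "S \<inter> A t = {}" if t: "P t" for t
  proof (rule ccontr)
    assume "S \<inter> A t \<noteq> {}"
    then have sub: "S - {chart M e t} \<subseteq> A t" using dicho t by blast
    have "infinite (S - {chart M e t})" using S by (auto simp: without_cut_points_def)
    then obtain x where x: "x \<in> S - {chart M e t}" using infinite_imp_nonempty by blast
    have "infinite (S - {chart M e t} - {x})" using S by (auto simp: without_cut_points_def)
    then obtain y where y: "y \<in> S - {chart M e t}" "y \<noteq> x" using infinite_imp_nonempty by blast
    have ch: "\<exists>a. P a \<and> z = chart M e a" if z: "z \<in> S - {chart M e t}" for z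
    proof -
      obtain a where "z = chart M e a" "a \<in> {min t t1<..<max t t1}" using subsetD[OF sub z] by (auto simp: A_def)
      then show ?thesis using between(1)[of t] t z by (auto simp: P_def split: if_splits)
    qed
    obtain a b where a: "P a" "x = chart M e a" and b: "P b" "y = chart M e b"
      using ch[OF x] ch[OF y(1)] by auto
    have False if ab: "P a" "P b" "\<bar>a - t1\<bar> < \<bar>b - t1\<bar>" "chart M e b \<in> S - {chart M e t}" for a b
    proof -
      have "chart M e a \<in> S \<inter> A b" using inA ab by (auto simp: P_def)
      then have "S - {chart M e b} \<subseteq> A b" using dicho ab by blast
      then have "chart M e t \<in> A b" using t ab by (auto simp: P_def)
      moreover have "chart M e b \<in> A t" using sub ab by auto
      ultimately show False using inA t ab by force
    qed
    moreover have "\<bar>a - t1\<bar> \<noteq> \<bar>b - t1\<bar>" using a b y(2) by (auto simp: P_def split: if_splits)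
    ultimately show False using a b x y by (metis linorder_neqE_linordered_idom)
  qed
  have claim2: "a = b" if "P a" "P b" for a b
  proof (rule ccontr)
    assume "a \<noteq> b"
    then have "\<bar>a - t1\<bar> < \<bar>b - t1\<bar> \<or> \<bar>b - t1\<bar> < \<bar>a - t1\<bar>" using that by (auto simp: P_def split: if_splits)
    then show False using claim1 inA that by (metis IntI P_def empty_iff)
  qed
  define Z where "Z = open_dom M e \<inter> (if t0 < t1 then {..<t1} else {t1<..})"
  have "openin (graph_topology M) (chart M e ` Z)"
    unfolding Z_def by (intro open_arc[OF mg e]) (auto simp: open_open_dom open_Int)
  moreover have "closedin (graph_topology M) {chart M e t0}"
    using closedin_singleton[OF mg] t0S subset_points by blast
  moreover have "S \<inter> chart M e ` Z = S \<inter> {chart M e t0}"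
  proof -
    have "P t" if "t \<in> Z" "chart M e t \<in> S" for t using that by (auto simp: Z_def P_def split: if_splits)
    moreover have "t0 \<in> Z" using t0 by (auto simp: Z_def)
    ultimately show ?thesis using claim2[OF P0] by auto
  qed
  ultimately have "S \<subseteq> {chart M e t0}"
    using connectedin_open_closed[OF without_cut_points_connected[OF S]] t0S by blast
  then show False using S finite_subset by (auto simp: without_cut_points_def)
qed

lemma edge_subset:
  assumes e: "e \<in> edges M" "e \<inter> S \<noteq> {}"
  shows "e \<union> ends M e \<subseteq> S"
proof -
  obtain c where c: "c \<in> open_dom M e" "chart M e c \<in> S"
    using e edge_chart[OF mg e(1)] by (metis disjoint_iff imageE)
  then have "chart M e t \<in> S" if "t \<in> closed_dom M e" for t
    using gap_in_edge[OF e(1) that _ c(1)] by auto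
  then have "chart M e ` closed_dom M e \<subseteq> S" by blast
  then show ?thesis by (simp add: chart_closed_image[OF mg e(1)])
qed

text \<open>
  A point of a ray in \<open>S\<close> would cut off the remaining tail of the ray.
\<close>
lemma edge_bounded:
  assumes e: "e \<in> edges M" "e \<inter> S \<noteq> {}"
  shows "bounded_edge M e"
proof (rule ccontr)
  assume "\<not> ?thesis"
  then have "len M e = \<infinity>" using e by (auto simp: bounded_edge_def)
  then have dom: "open_dom M e = {0<..}" "closed_dom M e = {0..}"
    by (auto simp: open_dom_def closed_dom_def)
  let ?p = "chart M e 1"
  have "openin (graph_topology M) (chart M e ` {1<..})" "closedin (graph_topology M) (chart M e ` {1..})"
    by (auto intro!: open_arc[OF mg e(1)] closed_arc[OF mg e(1)] simp: dom)
  moreover have "chart M e ` {1..} = insert ?p (chart M e ` {1<..})"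
  proof -
    have "{1..} = insert 1 {1::real<..}" by auto
    then show ?thesis by (metis image_insert)
  qed
  then have "(S - {?p}) \<inter> chart M e ` {1<..} = (S - {?p}) \<inter> chart M e ` {1..}" by auto
  moreover have "connectedin (graph_topology M) (S - {?p})"
    using S by (simp add: without_cut_points_def)
  ultimately have *: "(S - {?p}) \<inter> chart M e ` {1<..} = {} \<or> S - {?p} \<subseteq> chart M e ` {1<..}"
    using connectedin_open_closed by metis
  have inS: "chart M e t \<in> S" if "t > 0" for t
    using edge_subset[OF e] chart_open_in[OF mg e(1), of t] that dom by auto
  have inj: "chart M e s = chart M e t \<longleftrightarrow> s = t" if "s > 0" "t > 0" for s t
    using chart_inj[OF mg e(1)] that dom by (auto simp: inj_on_eq_iff)
  have "chart M e 2 \<in> (S - {?p}) \<inter> chart M e ` {1<..}" using inS[of 2] inj[of 2 1] by auto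
  moreover have "chart M e (1/2) \<in> S - {?p}" "chart M e (1/2) \<notin> chart M e ` {1<..}"
    using inS[of "1/2"] inj[of 1 "1/2"] by (auto simp: inj)
  ultimately show False using * by blast
qed

lemma edge_at_vertex:
  assumes u: "u \<in> verts M" "u \<in> S"
  shows "\<exists>e\<in>edges_at M u. e \<subseteq> S"
proof (rule ccontr)
  assume no: "\<not> ?thesis"
  have "e \<inter> S = {}" if "e \<in> edges_at M u" for e
    using that no edge_subset[of e] by (auto simp: edges_at_iff[OF mg])
  then have "S \<inter> insert u (\<Union>(edges_at M u)) = S \<inter> {u}" by auto
  moreover have "closedin (graph_topology M) {u}"
    using closedin_singleton[OF mg] u subset_points by blast
  ultimately have "S \<subseteq> {u}"
    using connectedin_open_closed[OF without_cut_points_connected[OF S] openin_star[OF mg u(1)]] u by blast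
  then show False using S finite_subset by (auto simp: without_cut_points_def)
qed

text \<open>
  If \<open>e\<close> were the only edge of \<open>S\<close> at \<open>u\<close> and not a loop, its
  midpoint would cut off the half edge at \<open>u\<close>. The two halves are parameters of the
  lemma, so that it applies to both orientations of \<open>e\<close>.
\<close>
lemma half_edge_separates:
  assumes e: "e \<in> edges M" "e \<subseteq> S" and u: "u \<in> verts M" "u \<in> S"
    and only: "\<And>f. f \<in> edges_at M u \<Longrightarrow> f \<subseteq> S \<Longrightarrow> f = e"
    and cl: "closed near" "closed far" "near \<union> far = closed_dom M e" "near \<inter> far = {m}" "m \<in> open_dom M e"
    and near: "\<And>t. t \<in> near \<Longrightarrow> t \<notin> open_dom M e \<Longrightarrow> chart M e t = u" "u \<in> chart M e ` near"
    and far: "\<And>t. t \<in> far \<Longrightarrow> t \<notin> open_dom M e \<Longrightarrow> chart M e t \<noteq> u" 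
    and x: "x \<in> far" "x \<in> open_dom M e" "x \<noteq> m"
  shows False
proof -
  let ?p = "chart M e m" and ?A = "insert u (\<Union>(edges_at M u)) - chart M e ` far"
  have ueq: "t \<notin> open_dom M e" if "t \<in> closed_dom M e" "chart M e t = u" for t
    using that u chart_open_in[OF mg e(1)] edge_verts_disjoint[OF mg e(1)] by blast
  have eat: "e \<in> edges_at M u"
    using near(2) ueq cl(3) chart_end[OF mg] by (auto simp: edges_at_iff[OF mg] e)
  have ufar: "u \<notin> chart M e ` far" using far ueq cl(3) by blast
  have same: "s = t" if "s \<in> open_dom M e" "t \<in> closed_dom M e" "chart M e s = chart M e t" for s t
  proof -
    have "t \<in> open_dom M e"
      using chart_in_edge_iff[OF mg e(1) e(1) that(2)] chart_open_in[OF mg e(1) that(1)] that by simp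
    then show ?thesis using that chart_inj[OF mg e(1)] by (simp add: inj_on_eq_iff)
  qed
  have eq: "(S - {?p}) \<inter> ?A = (S - {?p}) \<inter> chart M e ` near"
  proof
    show "(S - {?p}) \<inter> ?A \<subseteq> (S - {?p}) \<inter> chart M e ` near"
    proof
      fix y assume y: "y \<in> (S - {?p}) \<inter> ?A"
      have "y = u \<or> y \<in> e"
      proof (cases "y = u")
        case False
        then obtain f where f: "f \<in> edges_at M u" "y \<in> f" using y by auto
        then have "f \<subseteq> S" using edge_subset[of f] y by (auto simp: edges_at_iff[OF mg])
        then show ?thesis using only f by auto
      qed simp
      then show "y \<in> (S - {?p}) \<inter> chart M e ` near"
      proof
        assume "y \<in> e"
        then obtain t where "t \<in> closed_dom M e" "y = chart M e t"
          using edge_chart[OF mg e(1)] open_dom_subset[of M e] by blast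
        then show ?thesis using cl(3) y by blast
      qed (use near y in auto)
    qed
    show "(S - {?p}) \<inter> chart M e ` near \<subseteq> (S - {?p}) \<inter> ?A"
    proof
      fix y assume y: "y \<in> (S - {?p}) \<inter> chart M e ` near"
      then obtain t where t: "t \<in> near" "y = chart M e t" by auto
      show "y \<in> (S - {?p}) \<inter> ?A"
      proof (cases "t \<in> open_dom M e")
        case True
        then have "y \<in> e" using chart_open_in[OF mg e(1)] t by auto
        moreover have "y \<notin> chart M e ` far"
        proof
          assume "y \<in> chart M e ` far"
          then obtain s where "s \<in> far" "chart M e s = chart M e t" using t by auto
          then have "t = s" using same[OF True, of s] cl(3) by auto
          then have "t \<in> near \<inter> far" using t \<open>s \<in> far\<close> by simp
          then have "t = m" using cl(4) by simp
          then show False using y t by auto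
        qed
        ultimately show ?thesis using y eat by auto
      next
        case False
        then show ?thesis using near t y ufar by auto
      qed
    qed
  qed
  have "openin (graph_topology M) ?A" 
    using cl(2,3) by (intro openin_diff openin_star[OF mg u(1)] closed_arc[OF mg e(1)]) auto
  moreover have "closedin (graph_topology M) (chart M e ` near)"
    using cl(1,3) by (intro closed_arc[OF mg e(1)]) auto
  moreover have "connectedin (graph_topology M) (S - {?p})"
    using S by (simp add: without_cut_points_def)
  ultimately have "(S - {?p}) \<inter> ?A = {} \<or> S - {?p} \<subseteq> ?A"
    using connectedin_open_closed eq by metis
  moreover have "u \<in> (S - {?p}) \<inter> ?A" using u ufar cl(4,5) by auto
  moreover have "chart M e x \<in> S - {?p}"
    using x e chart_open_in[OF mg e(1)] same[OF x(2), of m] cl(4,5) open_dom_subset by blast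
  moreover have "chart M e x \<notin> ?A" using x by auto
  ultimately show False by blast
qed

lemma two_edges_at_vertex:
  assumes u: "u \<in> verts M" "u \<in> S"
  shows "\<exists>e\<in>edges_at M u. e \<subseteq> S \<and> (is_loop M e \<or> (\<exists>f\<in>edges_at M u. f \<subseteq> S \<and> f \<noteq> e))"
proof (rule ccontr)
  assume no: "\<not> ?thesis"
  obtain e where e: "e \<in> edges_at M u" "e \<subseteq> S" using edge_at_vertex[OF u] by auto
  then have only: "f = e" if "f \<in> edges_at M u" "f \<subseteq> S" for f using no that by blast
  have nl: "\<not> is_loop M e" using no e by blast
  have eE: "e \<in> edges M" using e by (simp add: edges_at_iff[OF mg])
  have "e \<inter> S \<noteq> {}" using e infinite_edge[OF mg eE] by (metis Int_absorb2 finite.emptyI)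
  then have b: "bounded_edge M e" using edge_bounded eE by blast
  then obtain l where l: "len M e = ereal l" "0 < l"
    using len_pos[OF mg eE] by (cases "len M e") (auto simp: bounded_edge_def)
  have dom: "open_dom M e = {0<..<l}" "closed_dom M e = {0..l}" using l by (auto simp: open_dom_def closed_dom_def)
  have uend: "u = src M e \<and> tgt M e \<noteq> u \<or> u = tgt M e \<and> src M e \<noteq> u"
    using e ends_eq[OF mg eE] b nl by (auto simp: edges_at_iff[OF mg] is_loop_def)
  have st: "src M e = chart M e 0" "tgt M e = chart M e l" using l by (auto simp: src_def tgt_def)
  show False
  proof (cases "u = src M e")
    case True
    show False
      by (rule half_edge_separates[OF eE e(2) u only, of "{0..l/2}" "{l/2..l}" "l/2" "3*l/4"])
        (use l dom uend st True in \<open>auto simp: not_less\<close>)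
  next
    case False
    show False
      by (rule half_edge_separates[OF eE e(2) u only, of "{l/2..l}" "{0..l/2}" "l/2" "l/4"])
        (use l dom uend st False in \<open>auto simp: not_less\<close>)
  qed
qed

lemma contains_vertex: "\<exists>u\<in>verts M. u \<in> S"
proof -
  obtain x where x: "x \<in> S" using S infinite_imp_nonempty by (fastforce simp: without_cut_points_def)
  show ?thesis
  proof (cases "x \<in> verts M")
    case False
    then obtain e where e: "e \<in> edges M" "x \<in> e" using x subset_points by (auto simp: points_def)
    then have "src M e \<in> S" using edge_subset[OF e(1)] x src_in_ends[OF mg e(1)] by auto
    then show ?thesis using src_in_ends[OF mg e(1)] ends_in_verts[OF mg e(1)] by auto
  qed (use x in auto)
qed

end

section \<open>Crowded graphs as topological spaces\<close>

text \<open>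
  The sets \<open>W i\<close> are kept apart from \<open>U i\<close> because trees glued at
  \<open>v1\<close> or \<open>v2\<close> are added to the parts \<open>U i\<close> and may
  disconnect them, while \<open>W i\<close> never changes.
\<close>
definition crowded_space ::
  "'a topology \<Rightarrow> 'a \<Rightarrow> 'a \<Rightarrow> (nat \<Rightarrow> 'a set) \<Rightarrow> (nat \<Rightarrow> 'a set) \<Rightarrow> (nat \<Rightarrow> 'a set) \<Rightarrow> bool" where
  "crowded_space T v1 v2 U W S \<longleftrightarrow> v1 \<noteq> v2 \<and> topspace T = {v1, v2} \<union> (\<Union>i\<in>{1,2,3}. U i) \<and>
     (\<forall>i\<in>{1,2,3}. openin T (U i) \<and> v1 \<notin> U i \<and> v2 \<notin> U i \<and>
        (\<forall>j\<in>{1,2,3}. i \<noteq> j \<longrightarrow> U i \<inter> U j = {}) \<and>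
        W i \<subseteq> U i \<and> connectedin T (W i) \<and> v1 \<in> T closure_of W i \<and> v2 \<in> T closure_of W i \<and>
        S i \<subseteq> W i \<and> without_cut_points T (S i))"

definition is_crowded :: "'a topology \<Rightarrow> bool" where
  "is_crowded T \<longleftrightarrow> (\<exists>v1 v2 U W S. crowded_space T v1 v2 U W S)"

lemma crowded_spaceD:
  assumes "crowded_space T v1 v2 U W S" "i \<in> {1,2,3}"
  shows "openin T (U i)" "v1 \<notin> U i" "v2 \<notin> U i" "W i \<subseteq> U i" "connectedin T (W i)"
    "v1 \<in> T closure_of W i" "v2 \<in> T closure_of W i" "S i \<subseteq> W i" "without_cut_points T (S i)"
    "j \<in> {1,2,3} \<Longrightarrow> i \<noteq> j \<Longrightarrow> U i \<inter> U j = {}"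
proof -
  have "\<forall>i\<in>{1,2,3}. openin T (U i) \<and> v1 \<notin> U i \<and> v2 \<notin> U i \<and>
      (\<forall>j\<in>{1,2,3}. i \<noteq> j \<longrightarrow> U i \<inter> U j = {}) \<and>
      W i \<subseteq> U i \<and> connectedin T (W i) \<and> v1 \<in> T closure_of W i \<and> v2 \<in> T closure_of W i \<and>
      S i \<subseteq> W i \<and> without_cut_points T (S i)"
    using assms(1) unfolding crowded_space_def by (elim conjE)
  note c = bspec[OF this assms(2)]
  then show "openin T (U i)" "v1 \<notin> U i" "v2 \<notin> U i" "W i \<subseteq> U i" "connectedin T (W i)"
    "v1 \<in> T closure_of W i" "v2 \<in> T closure_of W i" "S i \<subseteq> W i" "without_cut_points T (S i)"
    by blast+
  from c have disj: "\<forall>j\<in>{1,2,3}. i \<noteq> j \<longrightarrow> U i \<inter> U j = {}" by blast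
  show "U i \<inter> U j = {}" if "j \<in> {1,2,3}" "i \<noteq> j" using bspec[OF disj that(1)] that(2) by blast
qed

lemma crowded_space_cover:
  assumes "crowded_space T v1 v2 U W S"
  shows "v1 \<noteq> v2" "v1 \<in> topspace T" "v2 \<in> topspace T"
    "x \<in> topspace T \<Longrightarrow> x = v1 \<or> x = v2 \<or> (\<exists>i\<in>{1,2,3}. x \<in> U i)"
proof -
  have "v1 \<noteq> v2 \<and> topspace T = {v1, v2} \<union> (\<Union>i\<in>{1,2,3}. U i)"
    using assms unfolding crowded_space_def by (elim conjE) (rule conjI)
  then show "v1 \<noteq> v2" "v1 \<in> topspace T" "v2 \<in> topspace T"
    "x \<in> topspace T \<Longrightarrow> x = v1 \<or> x = v2 \<or> (\<exists>i\<in>{1,2,3}. x \<in> U i)" by simp_all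
qed

lemma connected_in_one_part:
  assumes cr: "crowded_space T v1 v2 U W S" and i: "i \<in> {1,2,3}"
    and A: "connectedin T A" "v1 \<notin> A" "v2 \<notin> A" "A \<inter> U i \<noteq> {}"
  shows "A \<subseteq> U i"
proof -
  let ?R = "\<Union>j\<in>{1,2,3} - {i}. U j"
  have cover: "A \<subseteq> U i \<union> ?R"
  proof
    fix x assume x: "x \<in> A"
    then have "x \<in> topspace T" using connectedin_subset_topspace[OF A(1)] by blast
    then obtain j where "j \<in> {1,2,3}" "x \<in> U j"
      using crowded_space_cover(4)[OF cr] A(2,3) x by blast
    then show "x \<in> U i \<union> ?R" by (cases "j = i") blast+
  qed
  have "openin T ?R" using crowded_spaceD(1)[OF cr] by (intro openin_Union) blast
  moreover have disj: "U i \<inter> ?R = {}" using crowded_spaceD(10)[OF cr i] by blast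
  ultimately have "?R \<inter> A = {}"
    using connectedinD[OF A(1) crowded_spaceD(1)[OF cr i] _ cover] A(4) by blast
  then show ?thesis using cover by blast
qed

lemma crowded_space_swap:
  assumes "crowded_space T v1 v2 U W S"
  shows "crowded_space T v2 v1 U W S"
proof -
  have "{v1, v2} = {v2, v1}" by auto
  then show ?thesis using assms unfolding crowded_space_def by metis
qed

text \<open>
  Indices are read modulo the length \<open>n\<close>, so the cycle may be started anywhere. After
  the removal of a vertex, the edges form a chain in which consecutive ones share a vertex different
  from the removed one. After the removal of a point of an edge, the other edges form a chain
  through both ends of that edge, and the two remaining pieces hang on these ends.
\<close>
lemma cycle_without_cut_points:
  assumes mg: "metric_graph M" and ne: "es \<noteq> []" and len: "length vs = length es"
    and dv: "distinct vs" and de: "distinct es"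
    and jn: "\<forall>i<length es. joins M (es ! i) (vs ! i) (vs ! (Suc i mod length es))"
  shows "without_cut_points (graph_topology M) (set vs \<union> \<Union>(set es))"
proof -
  let ?T = "graph_topology M"
  define n where "n = length es"
  have n: "n > 0" using ne by (simp add: n_def)
  define E where "E j = es ! (j mod n)" for j
  define V where "V j = vs ! (j mod n)" for j
  define A where "A j = E j \<union> {V j, V (Suc j)}" for j
  have "joins M (E j) (V j) (V (Suc j))" for j
    using jn n unfolding E_def V_def n_def by (metis mod_Suc_eq mod_less_divisor)
  then have Eedge: "E j \<in> edges M" and Eends: "ends M (E j) = {V j, V (Suc j)}" for j
    using ends_eq[OF mg, of "E j"] by (auto simp: joins_def bounded_edge_def)
  have Vvert: "V j \<in> verts M" for j using ends_in_verts[OF mg Eedge[of j]] Eends by auto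
  have Vinj: "V i = V j \<longleftrightarrow> i mod n = j mod n" for i j
    using dv n len by (simp add: V_def nth_eq_iff_index_eq n_def)
  have Einj: "E i = E j \<longleftrightarrow> i mod n = j mod n" for i j
    using de n by (simp add: E_def nth_eq_iff_index_eq n_def)
  have conn_part: "connectedin ?T B" if "E j \<subseteq> B" "B \<subseteq> A j" for j B
    using connectedin_edge_with_ends[OF mg Eedge that(1)] that(2) Eends by (simp add: A_def)
  have S: "set vs \<union> \<Union>(set es) = (\<Union>j<n. A (k + j))" for k
  proof
    have "\<exists>j<n. (k + j) mod n = i" if "i < n" for i
    (* The index (i - k) modulo n; adding a multiple of n keeps the subtraction from truncating. *)
    proof (intro exI conjI)
      have "k \<le> n * k" using n by simp
      then have "k + (i + n * k - k) = i + n * k" by linarith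
      then have "(k + (i + n * k - k)) mod n = i" using that by (metis mod_less mod_mult_self2)
      then show "(k + (i + n * k - k) mod n) mod n = i" by (metis mod_add_right_eq)
    qed (use n in simp)
    then have "vs ! i \<in> (\<Union>j<n. A (k + j)) \<and> es ! i \<subseteq> (\<Union>j<n. A (k + j))" if "i < n" for i
      using that by (force simp: A_def V_def E_def)
    then show "set vs \<union> \<Union>(set es) \<subseteq> (\<Union>j<n. A (k + j))"
      using len by (fastforce simp: in_set_conv_nth n_def)
    show "(\<Union>j<n. A (k + j)) \<subseteq> set vs \<union> \<Union>(set es)"
      using n len by (fastforce simp: A_def V_def E_def n_def)
  qed
  define Q where "Q k m = insert (V k) (\<Union>j<m. A (k + j))" for k m
  have Q_end: "V (k + m) \<in> Q k m" for k m
    by (cases m) (auto simp: Q_def A_def)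
  have Q_conn: "connectedin ?T (Q k m)" for k m
  proof (induction m)
    case 0
    then show ?case using Vvert by (simp add: Q_def topspace_graph[OF mg] points_def)
  next
    case (Suc m)
    have "Q k (Suc m) = Q k m \<union> A (k + m)" by (auto simp: Q_def lessThan_Suc)
    moreover have "connectedin ?T (A (k + m))" by (rule conn_part) (auto simp: A_def)
    moreover have "V (k + m) \<in> Q k m \<inter> A (k + m)" using Q_end by (auto simp: A_def)
    ultimately show ?case using Suc by (metis connectedin_Un empty_iff)
  qed
  have "connectedin ?T (set vs \<union> \<Union>(set es) - {p})" for p
  proof -
    consider (none) "p \<notin> set vs \<union> \<Union>(set es)" | (vert) k where "p = V k" | (edge) k where "p \<in> E k"
      unfolding S[of 0] A_def by blast
    then show ?thesis
    proof cases
      case none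
      have "Q 0 n = set vs \<union> \<Union>(set es)" using n by (auto simp: S[of 0] Q_def A_def)
      then show ?thesis using Q_conn[of 0 n] none by simp
    next
      case vert
      define B where "B j = A (k + j) - {p}" for j
      have pE: "p \<notin> E j" for j using edge_verts_disjoint[OF mg Eedge[of j]] Vvert vert by auto
      have "m < n \<Longrightarrow> connectedin ?T (\<Union>j<Suc m. B j)" for m
      proof (induction m)
        case 0
        have "(\<Union>j<Suc 0. B j) = B 0" by (simp add: lessThan_Suc)
        moreover have "connectedin ?T (B 0)" by (rule conn_part[of k]) (use pE in \<open>auto simp: A_def B_def\<close>)
        ultimately show ?case by simp
      next
        case (Suc m)
        have "(\<Union>j<Suc (Suc m). B j) = (\<Union>j<Suc m. B j) \<union> B (Suc m)" by (auto simp: lessThan_Suc)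
        moreover have "connectedin ?T (B (Suc m))"
          by (rule conn_part[of "k + Suc m"]) (use pE in \<open>auto simp: A_def B_def\<close>)
        moreover have "V (k + Suc m) \<noteq> p"
        proof
          assume "V (k + Suc m) = p"
          then have "(k + Suc m) mod n = k mod n" using vert Vinj by simp
          then have "n dvd Suc m" using mod_eq_dvd_iff_nat[of k "k + Suc m" n] by simp
          then show False using Suc.prems by (auto dest: dvd_imp_le)
        qed
        then have "V (k + Suc m) \<in> (\<Union>j<Suc m. B j) \<inter> B (Suc m)"
          by (auto simp: B_def A_def)
        ultimately show ?case using Suc by (metis Suc_lessD connectedin_Un empty_iff)
      qed
      from this[of "n - 1"] have "connectedin ?T (\<Union>j<n. B j)" using n by simp
      moreover have "set vs \<union> \<Union>(set es) - {p} = (\<Union>j<n. B j)" unfolding S[of k] B_def by blast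
      ultimately show ?thesis by simp
    next
      case edge
      (* The cycle without the open edge E k: it contains both ends of E k, also when n = 1. *)
      define D where "D = Q (Suc k) (n - 1)"
      have Vk: "V k \<in> D" "V (Suc k) \<in> D"
        using Q_end[of "Suc k" "n - 1"] n Vinj[of "Suc k + (n - 1)" k] by (auto simp: D_def Q_def)
      have pD: "p \<notin> D"
      proof -
        have "p \<notin> verts M" using edge_verts_disjoint[OF mg Eedge edge] .
        moreover have "p \<notin> E (Suc k + j)" if "j < n - 1" for j
        proof
          assume "p \<in> E (Suc k + j)"
          then have "E (Suc k + j) = E k" using edge_unique[OF mg Eedge Eedge _ edge] by blast
          then have "n dvd Suc j" using mod_eq_dvd_iff_nat[of k "Suc k + j" n] Einj by simp
          then show False using that by (auto dest: dvd_imp_le)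
        qed
        ultimately show ?thesis using Vvert by (auto simp: D_def Q_def A_def) 
      qed
      have SD: "set vs \<union> \<Union>(set es) = D \<union> E k"
      proof -
        have "{..<n} = insert 0 (Suc ` {..<n - 1})"
          using n by (cases n) (auto simp: lessThan_Suc_eq_insert_0)
        then have "set vs \<union> \<Union>(set es) = A k \<union> (\<Union>j<n-1. A (Suc k + j))"
          unfolding S[of k] by simp
        then show ?thesis using Vk by (auto simp: D_def Q_def A_def)
      qed
      obtain t0 where t0: "t0 \<in> open_dom M (E k)" "p = chart M (E k) t0"
        using edge edge_chart[OF mg Eedge[of k]] by blast
      have b: "bounded_edge M (E k)" using Eedge \<open>\<And>j. joins M (E j) (V j) (V (Suc j))\<close> by (simp add: joins_def)
      then obtain l where l: "len M (E k) = ereal l" "0 < l"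
        using len_pos[OF mg Eedge[of k]] by (cases "len M (E k)") (auto simp: bounded_edge_def)
      have dom: "closed_dom M (E k) = {0..l}" "open_dom M (E k) = {0<..<l}"
        using l by (auto simp: closed_dom_def open_dom_def)
      have c1: "connectedin ?T (chart M (E k) ` {0..<t0})" and c2: "connectedin ?T (chart M (E k) ` {t0<..l})"
        using t0 dom by (auto intro!: connectedin_arc[OF mg Eedge] simp: is_interval_cc is_interval_1)
      have e0: "chart M (E k) 0 \<in> D" and el: "chart M (E k) l \<in> D"
        using chart_end[OF mg, of 0 "E k"] chart_end[OF mg, of l "E k"] dom l Eends[of k] Vk by auto
      have split: "E k \<subseteq> insert p (chart M (E k) ` {0..<t0} \<union> chart M (E k) ` {t0<..l})"
      proof
        fix x assume "x \<in> E k"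
        then obtain t where t: "t \<in> open_dom M (E k)" "x = chart M (E k) t"
          using edge_chart[OF mg Eedge[of k]] by blast
        then show "x \<in> insert p (chart M (E k) ` {0..<t0} \<union> chart M (E k) ` {t0<..l})"
          using t0 dom by (cases t t0 rule: linorder_cases) auto
      qed
      have arcs: "chart M (E k) ` {0..<t0} \<union> chart M (E k) ` {t0<..l} \<subseteq> D \<union> E k - {p}"
      proof -
        have arc_in: "chart M (E k) t \<in> D \<union> E k - {p}" if t: "t \<in> {0..l}" "t \<noteq> t0" for t
        proof (cases "t \<in> open_dom M (E k)")
          case True
          then show ?thesis
            using chart_open_in[OF mg Eedge[of k]] chart_inj[OF mg Eedge[of k]] t0 t by (auto simp: inj_on_eq_iff)
        next
          case False
          then have "t = 0 \<or> t = l" using t dom by auto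
          then show ?thesis using e0 el pD by auto
        qed
        show ?thesis by (intro Un_least image_subsetI arc_in) (use t0 dom in auto)
      qed
      have "set vs \<union> \<Union>(set es) - {p} = (D \<union> chart M (E k) ` {0..<t0}) \<union> chart M (E k) ` {t0<..l}"
        unfolding SD using split arcs pD by blast
      moreover have "connectedin ?T (D \<union> chart M (E k) ` {0..<t0})"
        using Q_conn[of "Suc k" "n - 1"] c1 e0 t0 dom by (intro connectedin_Un) (auto simp: D_def)
      then have "connectedin ?T ((D \<union> chart M (E k) ` {0..<t0}) \<union> chart M (E k) ` {t0<..l})"
        using el t0 dom by (intro connectedin_Un[OF _ c2]) auto
      ultimately show ?thesis by simp
    qed
  qed
  moreover have "infinite (set vs \<union> \<Union>(set es))"
  proof -
    have "E 0 \<subseteq> set vs \<union> \<Union>(set es)" using n by (auto simp: E_def n_def)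
    then show ?thesis using infinite_edge[OF mg Eedge] finite_subset by blast
  qed
  ultimately show ?thesis by (simp add: without_cut_points_def)
qed

lemma openin_union_of_stars:
  assumes mg: "metric_graph M" and "V \<subseteq> verts M" "F \<subseteq> edges M" "\<And>u. u \<in> V \<Longrightarrow> edges_at M u \<subseteq> F"
  shows "openin (graph_topology M) (V \<union> \<Union>F)"
proof -
  have "V \<union> \<Union>F = (\<Union>u\<in>V. insert u (\<Union>(edges_at M u))) \<union> \<Union>F"
    using assms(4) by blast
  moreover have "openin (graph_topology M) \<dots>"
    using assms openin_star[OF mg] openin_edge[OF mg] by (intro openin_Un openin_Union) auto
  ultimately show ?thesis by simp
qed

lemma subgraph_ends:
  assumes "subgraph H M" "f \<in> edges H"
  shows "ends M f = ends H f" "ends M f \<subseteq> verts H" "f \<in> edges M" "closed_dom H f = closed_dom M f"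
    "chart H f = chart M f"
proof -
  have H: "metric_graph H" "f \<in> edges M" "len H f = len M f" "chart H f = chart M f"
    using assms by (auto simp: subgraph_def)
  then have "closed_dom H f = closed_dom M f" "open_dom H f = open_dom M f"
    by (simp_all add: closed_dom_def open_dom_def)
  then show "ends M f = ends H f" "ends M f \<subseteq> verts H" "f \<in> edges M" "closed_dom H f = closed_dom M f"
    "chart H f = chart M f"
    using H ends_in_verts[OF H(1) assms(2)] by (simp_all add: ends_def)
qed

lemma subgraph_inclusion_continuous:
  assumes "subgraph H M"
  shows "continuous_map (graph_topology H) (graph_topology M) (\<lambda>x. x)"
proof -
  have H: "metric_graph H" and M: "metric_graph M" using assms by (auto simp: subgraph_def)
  have "points H \<subseteq> points M" using assms by (auto simp: subgraph_def points_def)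
  moreover have "openin (graph_topology H) {x \<in> points H. x \<in> U}" if U: "openin (graph_topology M) U" for U
    unfolding openin_graph_topology
  proof (intro conjI ballI)
    fix f assume f: "f \<in> edges H"
    have "{t \<in> closed_dom H f. chart H f t \<in> {x \<in> points H. x \<in> U}} = {t \<in> closed_dom M f. chart M f t \<in> U}"
      using chart_in_points[OF H f] subgraph_ends[OF assms f] by auto
    then show "openin (top_of_set (closed_dom H f)) {t \<in> closed_dom H f. chart H f t \<in> {x \<in> points H. x \<in> U}}"
      using U subgraph_ends[OF assms f] by (simp add: openin_graph_topology)
  qed auto
  ultimately show ?thesis by (auto simp: continuous_map_def topspace_graph[OF H] topspace_graph[OF M])
qed

text \<open>
  Here \<open>U i = W i\<close> is the subgraph \<open>H i\<close> together with the two open edges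
  that join it to \<open>v1\<close> and \<open>v2\<close>.
\<close>
lemma crowded_graph_crowded_space:
  assumes "crowded_graph C"
  shows "is_crowded (graph_topology C)"
proof -
  let ?I = "{1,2,3::nat}" and ?T = "graph_topology C"
  have mg: "metric_graph C" using assms by (simp add: crowded_graph_def)
  obtain v1 v2 H e e' where v: "v1 \<noteq> v2"
    and H': "\<forall>i\<in>?I. subgraph (H i) C \<and> connected_graph (H i) \<and> has_cycle (H i) \<and>
            v1 \<notin> verts (H i) \<and> v2 \<notin> verts (H i)"
    and disj': "\<forall>i\<in>?I. \<forall>j\<in>?I. i \<noteq> j \<longrightarrow> disjnt (verts (H i)) (verts (H j))"
    and ee': "\<forall>i\<in>?I. (\<exists>w\<in>verts (H i). joins C (e i) v1 w) \<and> (\<exists>w\<in>verts (H i). joins C (e' i) v2 w)"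
    and vC: "verts C = {v1, v2} \<union> (\<Union>i\<in>?I. verts (H i))"
    and eC: "edges C = (\<Union>i\<in>?I. edges (H i)) \<union> e ` ?I \<union> e' ` ?I"
    using assms unfolding crowded_graph_def by (elim conjE exE) (rule that, assumption+)
  have H: "subgraph (H i) C \<and> connected_graph (H i) \<and> has_cycle (H i) \<and>
            v1 \<notin> verts (H i) \<and> v2 \<notin> verts (H i)" if "i \<in> ?I" for i using bspec[OF H' that] .
  have disj: "disjnt (verts (H i)) (verts (H j))" if "i \<in> ?I" "j \<in> ?I" "i \<noteq> j" for i j
    using bspec[OF bspec[OF disj' that(1)] that(2)] that(3) by (rule mp)
  have e: "\<exists>w\<in>verts (H i). joins C (e i) v1 w" and e': "\<exists>w\<in>verts (H i). joins C (e' i) v2 w"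
    if "i \<in> ?I" for i using bspec[OF ee' that] by blast+
  have jE: "f \<in> edges C \<and> ends C f = {a, b}" if "joins C f a b" for f a b
    using that ends_eq[OF mg, of f] by (auto simp: joins_def bounded_edge_def)
  define F where "F i = edges (H i) \<union> {e i, e' i}" for i
  define U where "U i = verts (H i) \<union> \<Union>(F i)" for i
  have Fsub: "F i \<subseteq> edges C" if "i \<in> ?I" for i
    using that eC unfolding F_def by blast
  have Fends: "ends C f \<subseteq> verts (H i) \<union> {v1, v2}" "ends C f \<inter> verts (H i) \<noteq> {}"
    if i: "i \<in> ?I" and f: "f \<in> F i" for i f
  proof -
    have "f \<in> edges (H i) \<Longrightarrow> ends C f \<subseteq> verts (H i) \<and> ends C f \<noteq> {}"
      using subgraph_ends[of "H i" C f] H[OF i] src_in_ends[OF mg, of f] by auto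
    then show "ends C f \<subseteq> verts (H i) \<union> {v1, v2}" "ends C f \<inter> verts (H i) \<noteq> {}"
      using f e[OF i] e'[OF i] jE by (fastforce simp: F_def)+
  qed
  have vdisj: "i = j" if "i \<in> ?I" "j \<in> ?I" "u \<in> verts (H i)" "u \<in> verts (H j)" for i j u
    using disj[of i j] that by (auto simp: disjnt_def)
  have vH: "v1 \<notin> verts (H i)" "v2 \<notin> verts (H i)" if "i \<in> ?I" for i using H that by auto
  have Fdisj: "i = j" if ij: "i \<in> ?I" "j \<in> ?I" and f: "f \<in> F i" "f \<in> F j" for i j f
  proof -
    obtain u where "u \<in> ends C f" "u \<in> verts (H i)" using Fends(2)[OF ij(1) f(1)] by auto
    then show ?thesis using Fends(1)[OF ij(2) f(2)] vH[OF ij(1)] vdisj[OF ij] by auto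
  qed
  have Hv: "verts (H i) \<subseteq> verts C" if "i \<in> ?I" for i using vC that by blast
  have Fcov: "\<exists>j\<in>?I. f \<in> F j" if "f \<in> edges C" for f
    using that unfolding eC F_def by blast
  have Uopen: "openin ?T (U i)" if i: "i \<in> ?I" for i
    unfolding U_def
  proof (rule openin_union_of_stars[OF mg Hv[OF i] Fsub[OF i]])
    fix u assume u: "u \<in> verts (H i)"
    show "edges_at C u \<subseteq> F i"
    proof
      fix f assume "f \<in> edges_at C u"
      then have f: "f \<in> edges C" "u \<in> ends C f" by (auto simp: edges_at_iff[OF mg])
      then obtain j where j: "j \<in> ?I" "f \<in> F j" using Fcov by blast
      then have "u \<in> verts (H j)" using Fends(1)[OF j] f u vH[OF i] by auto
      then show "f \<in> F i" using vdisj[OF i j(1) u] j by simp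
    qed
  qed
  have vU: "v1 \<notin> U i" "v2 \<notin> U i" if i: "i \<in> ?I" for i
    using vH[OF i] Fsub[OF i] edge_verts_disjoint[OF mg] vC unfolding U_def by blast+
  have Udisj: "U i \<inter> U j = {}" if ij: "i \<in> ?I" "j \<in> ?I" "i \<noteq> j" for i j
  proof (rule ccontr)
    assume "U i \<inter> U j \<noteq> {}"
    then obtain x where x: "x \<in> U i" "x \<in> U j" by auto
    show False
    proof (cases "x \<in> verts C")
      case True
      then have "x \<in> verts (H i)" "x \<in> verts (H j)"
        using x Fsub[OF ij(1)] Fsub[OF ij(2)] edge_verts_disjoint[OF mg] unfolding U_def by blast+
      then show False using vdisj ij by blast
    next
      case False
      then obtain f g where "f \<in> F i" "g \<in> F j" "x \<in> f" "x \<in> g"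
        using x Hv[OF ij(1)] Hv[OF ij(2)] unfolding U_def by blast
      then have "f = g" using edge_unique[OF mg] Fsub[OF ij(1)] Fsub[OF ij(2)] by blast
      then show False using Fdisj[OF ij(1,2)] \<open>f \<in> F i\<close> \<open>g \<in> F j\<close> ij by blast
    qed
  qed
  have cover: "topspace ?T = {v1, v2} \<union> (\<Union>i\<in>?I. U i)"
  proof
    show "topspace ?T \<subseteq> {v1, v2} \<union> (\<Union>i\<in>?I. U i)"
    proof
      fix x assume "x \<in> topspace ?T"
      then consider "x \<in> verts C" | f where "f \<in> edges C" "x \<in> f" 
        by (auto simp: topspace_graph[OF mg] points_def)
      then show "x \<in> {v1, v2} \<union> (\<Union>i\<in>?I. U i)"
      proof cases
        case 1
        then show ?thesis unfolding vC U_def by blast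
      next
        case 2
        then show ?thesis using Fcov unfolding U_def by blast
      qed
    qed
    show "{v1, v2} \<union> (\<Union>i\<in>?I. U i) \<subseteq> topspace ?T"
    proof -
      have "{v1, v2} \<subseteq> topspace ?T" using vC by (simp add: topspace_graph[OF mg] points_def)
      moreover have "(\<Union>i\<in>?I. U i) \<subseteq> topspace ?T" by (rule UN_least) (rule openin_subset[OF Uopen])
      ultimately show ?thesis by (rule Un_least)
    qed
  qed
  have Uconn: "connectedin ?T (U i)" and Ucl: "v1 \<in> ?T closure_of U i" "v2 \<in> ?T closure_of U i"
    if i: "i \<in> ?I" for i
  proof -
    have sub: "subgraph (H i) C" and "connected_graph (H i)" using H[OF i] by auto
    then have HG: "metric_graph (H i)" "connected_space (graph_topology (H i))"
      by (auto simp: connected_graph_def)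
    then have "connectedin (graph_topology (H i)) (points (H i))"
      by (metis connectedin_topspace topspace_graph)
    then have pc: "connectedin ?T (points (H i))"
      using connectedin_continuous_map_image[OF subgraph_inclusion_continuous[OF sub]] by fastforce
    obtain w w' where w: "w \<in> verts (H i)" "joins C (e i) v1 w" and w': "w' \<in> verts (H i)" "joins C (e' i) v2 w'"
      using e[OF i] e'[OF i] by auto
    note j = jE[OF w(2)] jE[OF w'(2)]
    have "connectedin ?T (insert w (e i))" "connectedin ?T (insert w' (e' i))"
      using j connectedin_edge_with_ends[OF mg, of "e i" "insert w (e i)"]
        connectedin_edge_with_ends[OF mg, of "e' i" "insert w' (e' i)"] by auto
    moreover have "w \<in> points (H i)" "w' \<in> points (H i)" using w w' by (auto simp: points_def)
    ultimately have "connectedin ?T ((points (H i) \<union> insert w (e i)) \<union> insert w' (e' i))"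
      using pc by (intro connectedin_Un) auto
    moreover have "(points (H i) \<union> insert w (e i)) \<union> insert w' (e' i) = U i"
      using w w' by (auto simp: U_def F_def points_def)
    ultimately show "connectedin ?T (U i)" by simp
    have "v1 \<in> ?T closure_of e i" "v2 \<in> ?T closure_of e' i"
      using ends_in_closure[OF mg, of "e i"] ends_in_closure[OF mg, of "e' i"] j by auto
    moreover have "e i \<subseteq> U i" "e' i \<subseteq> U i" by (auto simp: U_def F_def)
    ultimately show "v1 \<in> ?T closure_of U i" "v2 \<in> ?T closure_of U i"
      using closure_of_mono by blast+
  qed
  have "\<exists>S. S \<subseteq> U i \<and> without_cut_points ?T S" if i: "i \<in> ?I" for i
  proof -
    have sub: "subgraph (H i) C" and HG: "metric_graph (H i)" using H[OF i] by (auto simp: subgraph_def)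
    obtain vs es where c: "es \<noteq> []" "length vs = length es" "distinct vs" "distinct es"
      and jn: "\<forall>k<length es. joins (H i) (es ! k) (vs ! k) (vs ! (Suc k mod length es))"
      using H[OF i] unfolding has_cycle_def by blast
    have lift: "joins C f a b" if f: "joins (H i) f a b" for f a b
    proof -
      have "f \<in> edges (H i)" using f by (simp add: joins_def bounded_edge_def)
      then have "f \<in> edges C" "len (H i) f = len C f" "chart (H i) f = chart C f"
        using sub by (auto simp: subgraph_def)
      then show ?thesis using f by (simp add: joins_def bounded_edge_def src_def tgt_def)
    qed
    have jC: "joins C (es ! k) (vs ! k) (vs ! (Suc k mod length es))" if "k < length es" for k
      using jn that lift by blast
    have "es ! k \<in> edges (H i) \<and> vs ! k \<in> verts (H i)" if "k < length es" for k
    proof -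
      have "joins (H i) (es ! k) (vs ! k) (vs ! (Suc k mod length es))" using jn that by blast
      then have "es ! k \<in> edges (H i)" "vs ! k \<in> ends (H i) (es ! k)" 
        using ends_eq[OF HG, of "es ! k"] by (auto simp: joins_def bounded_edge_def)
      then show ?thesis using ends_in_verts[OF HG] by auto
    qed
    then have "set vs \<subseteq> verts (H i)" "set es \<subseteq> edges (H i)"
      using c(2) by (auto simp: in_set_conv_nth)
    then have "set vs \<union> \<Union>(set es) \<subseteq> U i" by (auto simp: U_def F_def)
    then show ?thesis using cycle_without_cut_points[OF mg c] jC by blast
  qed
  then obtain S where S: "\<And>i. i \<in> ?I \<Longrightarrow> S i \<subseteq> U i \<and> without_cut_points ?T (S i)" by metis
  have main: "openin ?T (U i) \<and> v1 \<notin> U i \<and> v2 \<notin> U i \<and>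
        (\<forall>j\<in>?I. i \<noteq> j \<longrightarrow> U i \<inter> U j = {}) \<and>
        U i \<subseteq> U i \<and> connectedin ?T (U i) \<and> v1 \<in> ?T closure_of U i \<and> v2 \<in> ?T closure_of U i \<and>
        S i \<subseteq> U i \<and> without_cut_points ?T (S i)" if i: "i \<in> ?I" for i
    using Uopen[OF i] vU[OF i] Udisj[OF i] Uconn[OF i] Ucl[OF i] S[OF i] by (intro conjI ballI impI) auto
  have "crowded_space ?T v1 v2 U U S"
    unfolding crowded_space_def by (intro conjI v cover, rule ballI, rule main)
  then show ?thesis unfolding is_crowded_def by blast
qed

section \<open>Gluing trees\<close>

text \<open>
  The map \<open>r\<close> is the retraction that collapses what is glued on to the points of
  attachment. The new parts are preimages under \<open>r\<close>; whatever is glued at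
  \<open>v1\<close> or \<open>v2\<close> is given to the part 1.
\<close>
lemma crowded_space_glue:
  assumes sub: "subgraph N N'"
    and cr: "crowded_space (graph_topology N) v1 v2 U W S"
    and r_in: "\<And>x. x \<in> points N' \<Longrightarrow> r x \<in> points N"
    and r_id: "\<And>x. x \<in> points N \<Longrightarrow> r x = x"
    and r_const: "\<And>f. f \<in> edges N' - edges N \<Longrightarrow> \<exists>c. \<forall>x\<in>f \<union> ends N' f. r x = c"
  shows "\<exists>U'. crowded_space (graph_topology N') v1 v2 U' W S"
proof -
  let ?I = "{1,2,3::nat}" and ?T = "graph_topology N" and ?T' = "graph_topology N'"
  have N: "metric_graph N" and N': "metric_graph N'" using sub by (auto simp: subgraph_def)
  have pts: "points N \<subseteq> points N'" using sub by (auto simp: subgraph_def points_def)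
  have c: "v1 \<noteq> v2" "points N = {v1, v2} \<union> (\<Union>i\<in>?I. U i)"
    using cr by (simp_all add: crowded_space_def topspace_graph[OF N])
  note Ui = crowded_spaceD[OF cr]
  define G where "G i = (if i = 1 then U i \<union> {v1, v2} else U i)" for i
  define U' where "U' i = {x \<in> points N'. r x \<in> G i} - {v1, v2}" for i
  have U'N: "x \<in> U' i \<longleftrightarrow> x \<in> U i" if "x \<in> points N" "i \<in> ?I" for x i
    using that r_id[OF that(1)] pts Ui(2,3)[OF that(2)] by (auto simp: U'_def G_def)
  have vN: "v1 \<in> points N" "v2 \<in> points N" using c by auto
  have v_closed: "closed {t \<in> closed_dom N' f. chart N' f t \<in> {v1, v2}}" if "f \<in> edges N'" for f
  proof -
    have "closedin ?T' {v1, v2}"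
      using closedin_singleton[OF N'] vN pts by (metis closedin_Un insert_is_Un subsetD)
    then show ?thesis using that by (simp add: closedin_graph_topology[OF N'])
  qed
  have U'_open: "openin ?T' (U' i)" if i: "i \<in> ?I" for i
    unfolding openin_graph_topology
  proof (intro conjI ballI)
    show "U' i \<subseteq> points N'" by (auto simp: U'_def)
    fix f assume f: "f \<in> edges N'"
    let ?D = "closed_dom N' f"
    show "openin (top_of_set ?D) {t \<in> ?D. chart N' f t \<in> U' i}"
    proof (cases "f \<in> edges N")
      case True
      note e = subgraph_ends[OF sub True]
      have eq: "{t \<in> ?D. chart N' f t \<in> U' i} = {t \<in> closed_dom N f. chart N f t \<in> U i}"
        using U'N[OF _ i] chart_in_points[OF N True] e by auto
      have "openin (top_of_set (closed_dom N f)) {t \<in> closed_dom N f. chart N f t \<in> U i}"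
        using Ui(1)[OF i] True by (simp add: openin_graph_topology)
      then show ?thesis unfolding eq e(4) .
    next
      case False
      then obtain c where c: "\<forall>x\<in>f \<union> ends N' f. r x = c" using r_const f by blast
      then have "r (chart N' f t) = c" if "t \<in> ?D" for t
        using that chart_closed_image[OF N' f] by blast
      then have "{t \<in> ?D. chart N' f t \<in> U' i} =
          (if c \<in> G i then ?D - {t \<in> ?D. chart N' f t \<in> {v1, v2}} else {})"
        using chart_in_points[OF N' f] by (auto simp: U'_def)
      moreover have "closedin (top_of_set ?D) {t \<in> ?D. chart N' f t \<in> {v1, v2}}"
        by (rule closed_subset[OF _ v_closed[OF f]]) auto
      then have "openin (top_of_set ?D) (?D - {t \<in> ?D. chart N' f t \<in> {v1, v2}})"
        by (rule openin_diff[OF openin_subtopology_self])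
      ultimately show ?thesis by (simp only: openin_empty split: if_split) simp
    qed
  qed
  have cover: "topspace ?T' = {v1, v2} \<union> (\<Union>i\<in>?I. U' i)"
  proof
    show "topspace ?T' \<subseteq> {v1, v2} \<union> (\<Union>i\<in>?I. U' i)"
      unfolding topspace_graph[OF N'] using r_in c(2) by (force simp: U'_def G_def)
    show "{v1, v2} \<union> (\<Union>i\<in>?I. U' i) \<subseteq> topspace ?T'"
      unfolding topspace_graph[OF N'] using vN pts by (auto simp: U'_def)
  qed
  have GG: "G i \<inter> G j = {}" if "i \<in> ?I" "j \<in> ?I" "i \<noteq> j" for i j
    using Ui(2,3)[OF that(1)] Ui(2,3)[OF that(2)] crowded_spaceD(10)[OF cr that] that by (auto simp: G_def)
  have incl: "continuous_map ?T ?T' (\<lambda>x. x)" by (rule subgraph_inclusion_continuous[OF sub])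
  have conn: "connectedin ?T' A" if "connectedin ?T A" for A
    using connectedin_continuous_map_image[OF incl that] by simp
  have clos: "?T closure_of A \<subseteq> ?T' closure_of A" for A
    using continuous_map_image_closure_subset[OF incl, of A] by simp
  have main: "openin ?T' (U' i) \<and> v1 \<notin> U' i \<and> v2 \<notin> U' i \<and>
        (\<forall>j\<in>?I. i \<noteq> j \<longrightarrow> U' i \<inter> U' j = {}) \<and>
        W i \<subseteq> U' i \<and> connectedin ?T' (W i) \<and> v1 \<in> ?T' closure_of W i \<and> v2 \<in> ?T' closure_of W i \<and>
        S i \<subseteq> W i \<and> without_cut_points ?T' (S i)" if i: "i \<in> ?I" for i
  proof (intro conjI ballI impI)
    show "openin ?T' (U' i)" by (rule U'_open[OF i])
    show "v1 \<notin> U' i" "v2 \<notin> U' i" by (auto simp: U'_def)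
    show "U' i \<inter> U' j = {}" if "j \<in> ?I" "i \<noteq> j" for j
      using GG[OF i that] by (auto simp: U'_def)
    have "U i \<subseteq> points N" using c(2) i by blast
    then show "W i \<subseteq> U' i" using Ui(4)[OF i] U'N[OF _ i] by blast
    show "connectedin ?T' (W i)" by (rule conn[OF Ui(5)[OF i]])
    show "v1 \<in> ?T' closure_of W i" "v2 \<in> ?T' closure_of W i"
      using clos Ui(6,7)[OF i] by auto
    show "S i \<subseteq> W i" by (rule Ui(8)[OF i])
    show "without_cut_points ?T' (S i)" using Ui(9)[OF i] conn by (simp add: without_cut_points_def)
  qed
  have "crowded_space ?T' v1 v2 U' W S"
    unfolding crowded_space_def using c(1) cover main by blast
  then show ?thesis by blast
qed

lemma delete_edges:
  assumes mg: "metric_graph M" and "V \<subseteq> verts M" "V \<noteq> {}" "F \<subseteq> edges M"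
    and ends: "\<And>f. f \<in> F \<Longrightarrow> ends M f \<subseteq> V"
  shows "subgraph (M\<lparr>verts := V, edges := F\<rparr>) M"
proof -
  let ?K = "M\<lparr>verts := V, edges := F\<rparr>"
  have e: "src M f \<in> V" "bounded_edge M f \<Longrightarrow> tgt M f \<in> V" if "f \<in> F" for f
    using ends[OF that] ends_eq[OF mg, of f] assms(4) that by auto
  have "metric_graph ?K"
    unfolding metric_graph_def
  proof (intro conjI ballI allI impI)
    show "finite (verts ?K)" "finite (edges ?K)" 
      using assms mg by (auto simp: metric_graph_def intro: finite_subset)
    show "verts ?K \<noteq> {}" using assms by simp
    show "pairwise disjnt (edges ?K)"
      using assms(4) mg by (auto simp: metric_graph_def intro: pairwise_subset)
    fix f
    show "f \<in> edges ?K \<Longrightarrow> disjnt f (verts ?K)"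
      using assms(2,4) edge_verts_disjoint[OF mg, of f] by (auto simp: disjnt_def)
    show "f \<in> edges ?K \<Longrightarrow> 0 < len ?K f"
      using assms(4) len_pos[OF mg] by auto
    show "f \<in> edges ?K \<Longrightarrow> bij_betw (chart ?K f) (open_dom ?K f) f"
      using assms(4) mg by (auto simp: metric_graph_def open_dom_def)
    show "f \<in> edges ?K \<Longrightarrow> src ?K f \<in> verts ?K"
      using e by (simp add: src_def)
    show "bounded_edge ?K f \<Longrightarrow> tgt ?K f \<in> verts ?K"
      using e(2)[of f] assms(4) by (auto simp: tgt_def bounded_edge_def)
  qed
  then show ?thesis using mg assms by (simp add: subgraph_def)
qed

text \<open>
  A step of the shrinking, read backwards, glues an edge at the vertex \<open>p\<close>. Here
  \<open>V\<close> is empty for an unbounded edge and consists of the leaf for a leaf edge.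
\<close>
lemma delete_edge_crowded:
  assumes K: "K = M\<lparr>verts := verts M - V, edges := edges M - {e}\<rparr>" and sub: "subgraph K M"
    and e: "e \<in> edges M" and p: "p \<in> verts M - V" and ends: "ends M e \<subseteq> insert p V"
    and V: "V \<subseteq> ends M e"
    and cr: "is_crowded (graph_topology K)"
  shows "is_crowded (graph_topology M)"
proof -
  obtain v1 v2 U W S where c: "crowded_space (graph_topology K) v1 v2 U W S"
    using cr by (auto simp: is_crowded_def)
  have mg: "metric_graph M" using sub by (simp add: subgraph_def)
  have Vv: "V \<subseteq> verts M" using V ends_in_verts[OF mg e] by auto
  define r where "r x = (if x \<in> e \<union> V then p else x)" for x
  have "\<exists>U'. crowded_space (graph_topology M) v1 v2 U' W S"
  proof (rule crowded_space_glue[OF sub c, of r])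
    show "r x \<in> points K" if "x \<in> points M" for x
      using that p by (auto simp: r_def points_def K)
    show "r x = x" if x: "x \<in> points K" for x
    proof -
      have "x \<notin> e" using x e edge_verts_disjoint[OF mg e] edge_unique[OF mg e] 
        by (auto simp: points_def K)
      moreover have "x \<notin> V" using x edge_verts_disjoint[OF mg] Vv by (auto simp: points_def K)
      ultimately show ?thesis by (simp add: r_def)
    qed
    show "\<exists>c. \<forall>x\<in>f \<union> ends M f. r x = c" if "f \<in> edges M - edges K" for f
      using that ends by (intro exI[of _ p]) (auto simp: r_def K)
  qed
  then show ?thesis unfolding is_crowded_def by blast
qed

text \<open>
  A loop leaves its vertex in two directions, so the only edge at a vertex of valence 1 is not a
  loop.
\<close>
lemma leaf_other_end:
  assumes mg: "metric_graph M" and v: "v \<in> verts M" "valence M v = 1"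
    and e: "bounded_edge M e" "e \<in> edges_at M v"
  shows "\<exists>w\<in>verts M. w \<noteq> v \<and> ends M e = {v, w}" "\<And>f. f \<in> edges_at M v \<Longrightarrow> f = e"
proof -
  obtain d where d: "directions M v = {d}" using v by (auto simp: valence_def card_1_singleton_iff)
  have eE: "e \<in> edges M" using e by (simp add: bounded_edge_def)
  have dir: "\<exists>b. (f, b) \<in> directions M v" if "f \<in> edges_at M v" for f
    using that by (auto simp: edges_at_def directions_def)
  show "f = e" if "f \<in> edges_at M v" for f
    using dir[OF that] dir[OF e(2)] d by auto
  have "\<not> (src M e = v \<and> tgt M e = v)"
  proof
    assume "src M e = v \<and> tgt M e = v"
    then have "(e, False) \<in> directions M v" "(e, True) \<in> directions M v"
      using e eE by (auto simp: directions_def)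
    then show False using d by auto
  qed
  then show "\<exists>w\<in>verts M. w \<noteq> v \<and> ends M e = {v, w}"
    using ends_eq[OF mg eE] e ends_in_verts[OF mg eE] by (auto simp: edges_at_iff[OF mg])
qed

lemma shrink_crowded:
  assumes "shrink M K" and mg: "metric_graph M"
  shows "metric_graph K \<and> (is_crowded (graph_topology K) \<longrightarrow> is_crowded (graph_topology M))"
  using assms(1)
proof cases
  case (unbounded e)
  have K: "K = M\<lparr>verts := verts M - {}, edges := edges M - {e}\<rparr>" using unbounded by simp
  have "ends M e = {src M e}" using ends_eq[OF mg, of e] unbounded by (simp add: bounded_edge_def)
  moreover have "src M e \<in> verts M" using src_in_ends[OF mg] ends_in_verts[OF mg] unbounded by blast
  moreover have sub: "subgraph K M"
    unfolding K using mg ends_in_verts[OF mg]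
    by (intro delete_edges) (auto simp: metric_graph_def)
  ultimately show ?thesis
    using delete_edge_crowded[OF K sub unbounded(2), of "src M e"] by (auto simp: subgraph_def)
next
  case (leaf v e)
  have K: "K = M\<lparr>verts := verts M - {v}, edges := edges M - {e}\<rparr>" using leaf by simp
  have eE: "e \<in> edges M" using leaf by (simp add: bounded_edge_def)
  obtain w where w: "w \<in> verts M" "w \<noteq> v" "ends M e = {v, w}"
    using leaf_other_end(1)[OF mg] leaf by blast
  have other: "f = e" if "f \<in> edges M" "v \<in> ends M f" for f
    using leaf_other_end(2)[OF mg, of v e f] leaf that by (simp add: edges_at_iff[OF mg])
  have sub: "subgraph K M"
    unfolding K
  proof (rule delete_edges[OF mg])
    show "ends M f \<subseteq> verts M - {v}" if "f \<in> edges M - {e}" for f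
      using that other[of f] ends_in_verts[OF mg, of f] by auto
  qed (use w in auto)
  then show ?thesis
    using delete_edge_crowded[OF K sub eE, of w] w by (auto simp: subgraph_def)
qed

lemma shrinks_crowded:
  assumes "shrink\<^sup>*\<^sup>* M K" and mg: "metric_graph M"
  shows "metric_graph K \<and> (is_crowded (graph_topology K) \<longrightarrow> is_crowded (graph_topology M))"
  using assms(1)
proof induction
  case base
  then show ?case using mg by simp
next
  case (step y z)
  then show ?case using shrink_crowded[of y z] by blast
qed

text \<open>
  Each tree is collapsed to its point of attachment \<open>p T\<close>. This is well defined because
  different trees only share points of \<open>N\<close>.
\<close>
lemma modification_crowded:
  assumes tm: "tropical_modification M M'" and cr: "is_crowded (graph_topology M)"
  shows "is_crowded (graph_topology M')"
proof -
  obtain N N' and Ts :: "'a model set" where models: "model_of N M" "model_of N' M'"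
    and sub: "subgraph N N'"
    and T: "\<forall>T\<in>Ts. subgraph T N' \<and> metric_tree T \<and> disjnt (edges T) (edges N) \<and>
            (\<exists>p. verts T \<inter> verts N = {p})"
    and TT: "\<forall>T\<in>Ts. \<forall>T'\<in>Ts. T \<noteq> T' \<longrightarrow>
            disjnt (edges T) (edges T') \<and> verts T \<inter> verts T' \<subseteq> verts N"
    and vN': "verts N' = verts N \<union> (\<Union>T\<in>Ts. verts T)"
    and eN': "edges N' = edges N \<union> (\<Union>T\<in>Ts. edges T)"
    using tm unfolding tropical_modification_def by (elim conjE exE) (rule that, assumption+)
  have N: "metric_graph N" and N': "metric_graph N'" using sub by (auto simp: subgraph_def)
  have Tsub: "subgraph T N'" "disjnt (edges T) (edges N)" if "T \<in> Ts" for T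
    using bspec[OF T that] by auto
  have "\<exists>p. verts T \<inter> verts N = {p}" if "T \<in> Ts" for T
    using bspec[OF T that] by auto
  then obtain p where p: "\<And>T. T \<in> Ts \<Longrightarrow> verts T \<inter> verts N = {p T}" by metis
  have in_verts: "x \<in> verts H" if "subgraph H N'" "x \<in> points H" "x \<in> verts N'" for x H
    using that edge_verts_disjoint[OF N'] by (auto simp: points_def subgraph_def)
  have in_edge: "f \<in> edges H" if h: "subgraph H N'" "x \<in> points H" "f \<in> edges N'" "x \<in> f" for x f H
  proof -
    have "x \<notin> verts H" using h edge_verts_disjoint[OF N' h(3,4)] by (auto simp: subgraph_def)
    then obtain g where g: "g \<in> edges H" "x \<in> g" using h(2) by (auto simp: points_def)
    then have "g \<in> edges N'" using h(1) by (auto simp: subgraph_def)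
    then have "f = g" using edge_unique[OF N' h(3) _ h(4)] g by blast
    then show ?thesis using g by simp
  qed
  have one_tree: "T = T'" if h: "T \<in> Ts" "T' \<in> Ts" "x \<in> points T" "x \<in> points T'" "x \<notin> points N" for T T' x
  proof (rule ccontr)
    assume "T \<noteq> T'"
    then have d: "disjnt (edges T) (edges T')" "verts T \<inter> verts T' \<subseteq> verts N"
      using bspec[OF bspec[OF TT h(1)] h(2)] by auto
    show False
    proof (cases "x \<in> verts N'")
      case True
      then have "x \<in> verts T" "x \<in> verts T'" using in_verts Tsub(1) h by blast+
      then show False using d h by (auto simp: points_def)
    next
      case False
      then obtain f where f: "f \<in> edges N'" "x \<in> f"
        using h(1,3) Tsub(1)[OF h(1)] by (auto simp: points_def subgraph_def)
      then have "f \<in> edges T" "f \<in> edges T'" using in_edge Tsub(1) h by blast+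
      then show False using d by (auto simp: disjnt_def)
    qed
  qed
  (* Points of N are kept; every other point lies in exactly one tree. *)
  define tr where "tr x = (SOME T. T \<in> Ts \<and> x \<in> points T)" for x
  define r where "r x = (if x \<in> points N then x else p (tr x))" for x
  have tr: "tr x = T" if "T \<in> Ts" "x \<in> points T" "x \<notin> points N" for x T
    unfolding tr_def using that one_tree by (intro some_equality) auto
  have r_tree: "r x = p T" if x: "T \<in> Ts" "x \<in> points T" "x \<notin> points N \<or> x \<in> verts T" for x T
  proof (cases "x \<in> points N")
    case True
    then have xT: "x \<in> verts T" using x by simp
    then have "x \<in> verts N'" using Tsub(1)[OF x(1)] by (auto simp: subgraph_def)
    then have "x \<in> verts N" using in_verts[OF sub True] by simp
    then show ?thesis using p[OF x(1)] xT True by (auto simp: r_def)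
  next
    case False
    then show ?thesis using tr[OF x(1,2)] by (simp add: r_def)
  qed
  obtain v1 v2 U W S where c: "crowded_space (graph_topology N) v1 v2 U W S"
    using cr model_of_same_topology(1)[OF models(1)] by (auto simp: is_crowded_def)
  have "\<exists>U'. crowded_space (graph_topology N') v1 v2 U' W S"
  proof (rule crowded_space_glue[OF sub c, of r])
    show "r x \<in> points N" if x: "x \<in> points N'" for x
    proof (cases "x \<in> points N")
      case False
      then obtain T where T: "T \<in> Ts" "x \<in> points T"
        using x unfolding points_def vN' eN' by blast
      then have "r x = p T" using r_tree False by blast
      then show ?thesis using p[OF T(1)] by (auto simp: points_def)
    qed (simp add: r_def)
    show "r x = x" if "x \<in> points N" for x using that by (simp add: r_def)
    show "\<exists>c. \<forall>x\<in>f \<union> ends N' f. r x = c" if f: "f \<in> edges N' - edges N" for f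
    proof -
      obtain T where T: "T \<in> Ts" "f \<in> edges T" using f unfolding eN' by blast
      note te = subgraph_ends[OF Tsub(1)[OF T(1)] T(2)]
      have "r x = p T" if x: "x \<in> f \<union> ends N' f" for x
      proof (rule r_tree[OF T(1)])
        show "x \<in> points T" using x T te by (auto simp: points_def)
        show "x \<notin> points N \<or> x \<in> verts T"
          using x te in_edge[OF sub, of x f] f by auto
      qed
      then show ?thesis by blast
    qed
  qed
  then have "is_crowded (graph_topology N')" unfolding is_crowded_def by blast
  then show ?thesis by (simp only: model_of_same_topology(1)[OF models(2)])
qed

lemma crowded_pattern_modification:
  assumes "metric_graph M" "has_crowded_pattern M" "tropical_modification M M'"
  shows "is_crowded (graph_topology M')"
proof -
  obtain C K where "shrink\<^sup>*\<^sup>* M K" "model_of C K" "crowded_graph C"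
    using assms(2) by (auto simp: has_crowded_pattern_def canonical_model_def)
  moreover from this have "is_crowded (graph_topology K)"
    using crowded_graph_crowded_space[of C] model_of_same_topology(1)[of C K] by simp
  ultimately show ?thesis
    using shrinks_crowded[OF _ assms(1)] modification_crowded[OF assms(3)] by blast
qed

section \<open>Harmonic maps to an interval\<close>

definition degree_over :: "'a model \<Rightarrow> 'b model \<Rightarrow> ('a \<Rightarrow> 'b) \<Rightarrow> 'a set \<Rightarrow> 'b \<Rightarrow> nat" where
  "degree_over M N \<phi> U y = (\<Sum>u | u \<in> verts M \<and> u \<in> U \<and> \<phi> u = y. mult M N \<phi> u)"

text \<open>
  The maps \<open>h\<close> and \<open>k\<close> identify the target with an interval of the real
  line; \<open>h\<close> serves as a coordinate.
\<close>
locale path_cover =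
  fixes M :: "'a model" and N :: "'b model" and \<phi> :: "'a \<Rightarrow> 'b" and d :: nat
    and h :: "'b \<Rightarrow> real" and k :: "real \<Rightarrow> 'b" and I :: "real set"
  assumes morphism: "model_morphism M N \<phi>" and harmonic: "harmonic M N \<phi>"
    and degree: "has_degree M N \<phi> d" and nondegenerate: "nondegenerate M N \<phi>"
    and interval: "is_interval I"
    and line: "homeomorphic_maps (graph_topology N) (top_of_set I) h k"
begin

lemma M: "metric_graph M" and N: "metric_graph N"
  using morphism by (auto simp: model_morphism_def)

lemma phi_continuous: "continuous_map (graph_topology M) (graph_topology N) \<phi>"
  using morphism by (simp add: model_morphism_def)

lemma phi_verts: "u \<in> verts M \<Longrightarrow> \<phi> u \<in> verts N"
  using morphism by (auto simp: model_morphism_def)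

lemma phi_points: "x \<in> points M \<Longrightarrow> \<phi> x \<in> points N"
  using continuous_map_image_subset_topspace[OF phi_continuous]
  by (auto simp: topspace_graph[OF M] topspace_graph[OF N])

lemma edge_cases: "e \<in> edges M \<Longrightarrow> \<phi> ` e \<in> edges N \<or> (\<exists>y\<in>verts N. \<phi> ` e = {y})"
  using morphism by (auto simp: model_morphism_def)

lemma vert_point: "y \<in> verts N \<Longrightarrow> y \<in> points N" "u \<in> verts M \<Longrightarrow> u \<in> points M"
  by (auto simp: points_def)

lemma h_continuous: "continuous_map (graph_topology N) euclideanreal h"
  using line by (auto simp: homeomorphic_maps_def continuous_map_in_subtopology)

lemma k_h: "x \<in> points N \<Longrightarrow> k (h x) = x"
  using line by (simp add: homeomorphic_maps_def topspace_graph[OF N])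

lemma h_k: "t \<in> I \<Longrightarrow> h (k t) = t"
  using line by (simp add: homeomorphic_maps_def)

lemma h_in_I: "x \<in> points N \<Longrightarrow> h x \<in> I"
  using line by (auto simp: homeomorphic_maps_def continuous_map_in_subtopology topspace_graph[OF N])

lemma h_inj: "x \<in> points N \<Longrightarrow> y \<in> points N \<Longrightarrow> h x = h y \<longleftrightarrow> x = y"
  using k_h by metis

lemma h_connected: "connectedin (graph_topology N) A \<Longrightarrow> is_interval (h ` A)"
  using connectedin_continuous_map_image[OF h_continuous] by (simp add: is_interval_connected_1)

lemma connectedin_segment:
  assumes "{a..b} \<subseteq> I" shows "connectedin (graph_topology N) (k ` {a..b})"
proof -
  have "continuous_map (top_of_set I) (graph_topology N) k"
    using line by (simp add: homeomorphic_maps_def)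
  moreover have "connectedin (top_of_set I) {a..b}" using assms by (simp add: connectedin_subtopology)
  ultimately show ?thesis by (rule connectedin_continuous_map_image)
qed

lemma one_sided:
  assumes "connectedin (graph_topology N) A" "y \<in> points N" "y \<notin> A"
  shows "(\<forall>q\<in>A. h q < h y) \<or> (\<forall>q\<in>A. h y < h q)"
proof (rule ccontr)
  assume "\<not> ?thesis"
  then obtain p q where pq: "p \<in> A" "q \<in> A" "h y \<le> h p" "h q \<le> h y" by (auto simp: not_less)
  then have "h y \<in> h ` A" using h_connected[OF assms(1)] by (meson image_eqI mem_is_interval_1_I)
  moreover have "A \<subseteq> points N" using connectedin_subset_topspace[OF assms(1)] by (simp add: topspace_graph[OF N])
  ultimately show False using h_inj assms by (metis imageE subsetD)
qed

lemma edge_point: "e \<in> edges N \<Longrightarrow> q \<in> e \<Longrightarrow> q \<in> points N"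
  by (auto simp: points_def)

text \<open>
  At a vertex of the path there is at most one edge on each side. Two of them would both accumulate
  at \<open>y\<close> from the same side, and their images under \<open>h\<close> are intervals, so
  they would overlap.
\<close>
lemma edges_on_one_side:
  assumes e: "e \<in> edges_at N y" "f \<in> edges_at N y" and q: "p \<in> e" "q \<in> f"
    and same: "h p < h y \<and> h q < h y \<or> h y < h p \<and> h y < h q"
  shows "e = f"
proof -
  have *: "e = f" if ef: "e \<in> edges_at N y" "f \<in> edges_at N y" and q: "p \<in> e" "q \<in> f"
    and between: "h q \<le> h p \<and> h p < h y \<or> h y < h p \<and> h p \<le> h q" for e f p q
  proof -
    have E: "e \<in> edges N" "f \<in> edges N" "y \<in> ends N f" using ef by (auto simp: edges_at_iff[OF N])
    then have "connectedin (graph_topology N) (insert y f)"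
      by (intro connectedin_edge_with_ends[OF N, of f]) auto
    then have "is_interval (h ` insert y f)" by (rule h_connected)
    then have "h p \<in> h ` insert y f"
      using between q(2) by (meson image_eqI insertCI insertI1 less_imp_le mem_is_interval_1_I)
    then obtain z where z: "z \<in> insert y f" "h p = h z" by blast
    have "z \<in> points N" using z E ends_in_verts[OF N E(2)] by (auto simp: points_def)
    then have "p = z" using z(2) h_inj edge_point[OF E(1) q(1)] by simp
    moreover have "p \<noteq> y" using between by auto
    ultimately have "p \<in> f" using z by auto
    then show ?thesis using edge_unique[OF N E(1,2) q(1)] by simp
  qed
  show ?thesis using *[OF e q] *[OF e(2,1) q(2,1)] same by fastforce
qed

text \<open>
  Along a loop the coordinate would start and end with the same value, and so take an intermediate
  value twice in the interior.
\<close>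
lemma no_loops:
  assumes "bounded_edge N e"
  shows "src N e \<noteq> tgt N e"
proof
  assume loop: "src N e = tgt N e"
  have e: "e \<in> edges N" using assms by (simp add: bounded_edge_def)
  obtain l where l: "len N e = ereal l" "0 < l"
    using len_pos[OF N e] assms by (cases "len N e") (auto simp: bounded_edge_def)
  have dom: "closed_dom N e = {0..l}" "open_dom N e = {0<..<l}"
    using l by (auto simp: closed_dom_def open_dom_def)
  define g where "g t = h (chart N e t)" for t
  have "continuous_map (top_of_set (closed_dom N e)) euclideanreal (h \<circ> chart N e)"
    by (rule continuous_map_compose[OF chart_continuous[OF N e] h_continuous])
  then have g: "continuous_on {0..l} g" by (simp add: dom g_def comp_def)
  have inj: "s = t" if "s \<in> {0<..<l}" "t \<in> {0..l}" "g s = g t" for s t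
  proof -
    have "chart N e s = chart N e t"
      using that h_inj chart_in_points[OF N e] dom by (simp add: g_def)
    moreover have "t \<in> open_dom N e"
      using calculation chart_in_edge_iff[OF N e e] chart_open_in[OF N e, of s] that dom by auto
    ultimately show ?thesis using chart_inj[OF N e] that dom by (simp add: inj_on_eq_iff)
  qed
  have ends: "g 0 = g l" using loop l by (simp add: g_def src_def tgt_def)
  (* A value strictly between those at the end and at the midpoint is taken on both halves. *)
  define c where "c = (g 0 + g (l/2)) / 2"
  have ne: "g (l/2) \<noteq> g 0" using inj[of "l/2" 0] l by auto
  have conn: "is_interval (g ` {0..l/2})" "is_interval (g ` {l/2..l})"
    using l by (auto simp: is_interval_connected_1 intro!: connected_continuous_image continuous_on_subset[OF g])
  have mid: "g 0 \<le> c \<and> c \<le> g (l/2) \<or> g (l/2) \<le> c \<and> c \<le> g 0" "c \<noteq> g 0" "c \<noteq> g (l/2)"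
    using ne by (auto simp: c_def field_simps)
  have "c \<in> g ` {0..l/2}" 
    using mid(1) mem_is_interval_1_I[OF conn(1), of "g 0" "g (l/2)" c] 
      mem_is_interval_1_I[OF conn(1), of "g (l/2)" "g 0" c] l by auto
  moreover have "c \<in> g ` {l/2..l}"
    using mid(1) mem_is_interval_1_I[OF conn(2), of "g l" "g (l/2)" c] 
      mem_is_interval_1_I[OF conn(2), of "g (l/2)" "g l" c] l ends by auto
  ultimately obtain s t where st: "s \<in> {0..l/2}" "t \<in> {l/2..l}" "c = g s" "c = g t" by blast
  then have "s \<noteq> 0" "s \<noteq> l/2" using mid by auto
  then have "s = t" using inj[of s t] st l by auto
  then show False using st \<open>s \<noteq> l/2\<close> by auto
qed

lemma stretch_exists:
  assumes "e \<in> edges M" "\<phi> ` e \<in> edges N"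
  shows "\<exists>n>0. has_stretch M N \<phi> e n"
proof -
  have "\<not> (\<exists>y\<in>verts N. \<phi> ` e = {y})"
    using edge_verts_disjoint[OF N assms(2)] by auto
  moreover have "\<phi> ` e \<in> edges N \<and> (\<exists>n>0. has_stretch M N \<phi> e n) \<or> (\<exists>y\<in>verts N. \<phi> ` e = {y})"
    using morphism assms(1) by (simp add: model_morphism_def)
  ultimately show ?thesis by blast
qed

lemma bounded_image:
  assumes "e \<in> edges M" "\<phi> ` e \<in> edges N"
  shows "bounded_edge N (\<phi> ` e) \<longleftrightarrow> bounded_edge M e"
proof -
  obtain n where n: "has_stretch M N \<phi> e n" using stretch_exists[OF assms] by auto
  show ?thesis
  proof (cases "len M e")
    case (real l)
    then have "len N (\<phi> ` e) / ereal l = ereal (real n)" "0 < l"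
      using n len_pos[OF M assms(1)] by (auto simp: has_stretch_def)
    then have "len N (\<phi> ` e) \<noteq> \<infinity>" by auto
    then show ?thesis using real assms by (simp add: bounded_edge_def)
  next
    case PInf
    then show ?thesis using n assms by (simp add: has_stretch_def bounded_edge_def)
  next
    case MInf
    then show ?thesis using len_pos[OF M assms(1)] by simp
  qed
qed

lemma stretch_pos:
  assumes e: "e \<in> edges M" "\<phi> ` e \<in> edges N"
  shows "stretch M N \<phi> e > 0"
proof -
  obtain n where n: "n > 0" "has_stretch M N \<phi> e n" using stretch_exists[OF e] by auto
  have uniq: "m = n" if m: "has_stretch M N \<phi> e m" for m
  proof (cases "len M e < \<infinity>")
    case True
    then show ?thesis using n m by (simp add: has_stretch_def)
  next
    case False
    then have inf: "len M e = \<infinity>" "len N (\<phi> ` e) = \<infinity>" using n by (auto simp: has_stretch_def)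
    have one: "1 \<in> open_dom M e" using inf by (simp add: open_dom_def)
    have eq: "\<phi> (chart M e 1) = chart N (\<phi> ` e) (real m)" "\<phi> (chart M e 1) = chart N (\<phi> ` e) (real n)"
      using n m one False by (auto simp: has_stretch_def)
    have "real n \<in> open_dom N (\<phi> ` e)" "real m \<in> closed_dom N (\<phi> ` e)"
      using n inf by (auto simp: open_dom_def closed_dom_def)
    moreover have "\<phi> (chart M e 1) \<in> \<phi> ` e" using chart_open_in[OF M e(1) one] by blast
    ultimately have "real m \<in> open_dom N (\<phi> ` e)" "real n \<in> open_dom N (\<phi> ` e)"
      using chart_in_edge_iff[OF N e(2) e(2), of "real m"] eq by auto
    then have "real m = real n" using chart_inj[OF N e(2)] eq by (metis inj_onD)
    then show ?thesis by simp
  qed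
  have "(THE n. has_stretch M N \<phi> e n) = n"
    by (rule the_equality[where P = "has_stretch M N \<phi> e", OF n(2) uniq])
  then show ?thesis using n e by (simp add: stretch_def)
qed

lemma phi_closure: "x \<in> graph_topology M closure_of A \<Longrightarrow> \<phi> x \<in> graph_topology N closure_of (\<phi> ` A)"
  using continuous_map_image_closure_subset[OF phi_continuous] by blast

lemma end_of_contracted:
  assumes "e \<in> edges M" "\<phi> ` e = {y}" "u \<in> ends M e"
  shows "\<phi> u = y"
proof -
  have "y \<in> points N"
    using assms phi_points edge_cases[OF assms(1)] by (auto simp: points_def)
  then have "graph_topology N closure_of {y} = {y}"
    by (intro closure_of_closedin closedin_singleton[OF N])
  then show ?thesis using phi_closure[of u e] ends_in_closure[OF M assms(1)] assms by auto
qed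

lemma ends_to_ends:
  assumes e: "e \<in> edges M" "\<phi> ` e \<in> edges N" and u: "u \<in> ends M e"
  shows "\<phi> u \<in> ends N (\<phi> ` e)"
proof -
  have "\<phi> u \<in> graph_topology N closure_of (\<phi> ` e)"
    using phi_closure[of u e] ends_in_closure[OF M e(1)] u by auto
  also have "\<dots> \<subseteq> \<phi> ` e \<union> ends N (\<phi> ` e)"
    by (rule closure_of_minimal[OF _ closedin_closed_edge[OF N e(2)]]) auto
  finally have "\<phi> u \<in> \<phi> ` e \<union> ends N (\<phi> ` e)" .
  moreover have "\<phi> u \<in> verts N" using u ends_in_verts[OF M e(1)] phi_verts by auto
  ultimately show ?thesis using edge_verts_disjoint[OF N e(2)] by auto
qed

text \<open>
  A morphism need not be linear, or even injective, on a bounded edge. But the image of the closed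
  edge is compact and contains the open edge below, hence also its ends, and interior points are not
  mapped to vertices.
\<close>
lemma ends_onto_ends:
  assumes e: "e \<in> edges M" "\<phi> ` e \<in> edges N" and y: "y \<in> ends N (\<phi> ` e)"
  shows "\<exists>u\<in>ends M e. \<phi> u = y"
proof (cases "bounded_edge M e")
  case False
  then have "ends N (\<phi> ` e) = {src N (\<phi> ` e)}"
    using bounded_image[OF e] ends_eq[OF N e(2)] by simp
  then show ?thesis using ends_to_ends[OF e src_in_ends[OF M e(1)]] src_in_ends[OF M e(1)] y by auto
next
  case True
  then obtain l where l: "len M e = ereal l" "0 < l"
    using len_pos[OF M e(1)] by (cases "len M e") (auto simp: bounded_edge_def)
  have dom: "closed_dom M e = {0..l}" using l by (auto simp: closed_dom_def)
  have yv: "y \<in> verts N" using y ends_in_verts[OF N e(2)] by auto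
  define g where "g t = h (\<phi> (chart M e t))" for t
  have "continuous_map (top_of_set (closed_dom M e)) euclideanreal (h \<circ> (\<phi> \<circ> chart M e))"
    by (rule continuous_map_compose[OF continuous_map_compose[OF chart_continuous[OF M e(1)] phi_continuous] h_continuous])
  then have "continuous_on {0..l} g" by (simp add: dom g_def comp_def)
  then have cl: "closed (g ` {0..l})" by (intro compact_imp_closed compact_continuous_image) auto
  have "h ` (\<phi> ` e) \<subseteq> g ` {0..l}"
  proof -
    have "x \<in> chart M e ` {0..l}" if "x \<in> e" for x
      using that chart_closed_image[OF M e(1)] dom by auto
    then show ?thesis unfolding g_def by blast
  qed
  then have "closure (h ` (\<phi> ` e)) \<subseteq> g ` {0..l}" using cl by (rule closure_minimal)
  moreover have "h y \<in> closure (h ` (\<phi> ` e))"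
  proof -
    have "y \<in> graph_topology N closure_of (\<phi> ` e)" using ends_in_closure[OF N e(2)] y by blast
    then show ?thesis using continuous_map_image_closure_subset[OF h_continuous, of "\<phi> ` e"] by auto
  qed
  ultimately obtain t where t: "t \<in> {0..l}" "h y = h (\<phi> (chart M e t))" by (auto simp: g_def)
  then have eq: "\<phi> (chart M e t) = y"
    using h_inj phi_points chart_in_points[OF M e(1)] dom vert_point(1)[OF yv] by metis
  have "t \<notin> open_dom M e"
  proof
    assume "t \<in> open_dom M e"
    then have "y \<in> \<phi> ` e" using chart_open_in[OF M e(1)] eq by blast
    then show False using edge_verts_disjoint[OF N e(2)] yv by blast
  qed
  then show ?thesis using eq t chart_end[OF M] dom by auto
qed

lemma unique_end_over:
  assumes e: "e \<in> edges M" "\<phi> ` e \<in> edges N" and u: "u \<in> ends M e" "w \<in> ends M e" "\<phi> u = \<phi> w"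
  shows "u = w"
proof (rule ccontr)
  assume ne: "u \<noteq> w"
  then have b: "bounded_edge M e" using u ends_eq[OF M e(1)] by (auto split: if_splits)
  then have "ends M e = {u, w}" using u ne ends_eq[OF M e(1)] by auto
  then have "z = \<phi> u" if "z \<in> ends N (\<phi> ` e)" for z using ends_onto_ends[OF e that] u by auto
  then have "ends N (\<phi> ` e) \<subseteq> {\<phi> u}" by blast
  then show False using no_loops[of "\<phi> ` e"] b bounded_image[OF e] ends_eq[OF N e(2)] by auto
qed

lemma no_loop_over_edge:
  assumes "\<phi> ` e \<in> edges N" shows "\<not> is_loop M e"
proof
  assume l: "is_loop M e"
  then have e: "e \<in> edges M" "bounded_edge M e" by (auto simp: is_loop_def bounded_edge_def)
  then have "ends M e = {src M e}" using l ends_eq[OF M e(1)] by (auto simp: is_loop_def)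
  then have "z = \<phi> (src M e)" if "z \<in> ends N (\<phi> ` e)" for z using ends_onto_ends[OF e(1) assms that] by auto
  then have "ends N (\<phi> ` e) \<subseteq> {\<phi> (src M e)}" by blast
  then show False using no_loops[of "\<phi> ` e"] e bounded_image[OF e(1) assms] ends_eq[OF N assms] by auto
qed

lemma no_loop: "\<not> is_loop M e"
  using nondegenerate no_loop_over_edge by (auto simp: nondegenerate_def)

lemma finite_edges: "finite (edges M)" "finite (verts M)" "finite (edges_at M u)"
  using M by (auto simp: metric_graph_def edges_at_def)

lemma image_edge_at:
  assumes "e \<in> edges_at M u" "\<phi> ` e \<in> edges N"
  shows "\<phi> ` e \<in> edges_at N (\<phi> u)"
  using assms ends_to_ends by (auto simp: edges_at_iff[OF M] edges_at_iff[OF N])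

lemma edge_over:
  assumes "u \<in> verts M"
  shows "\<exists>e\<in>edges_at M u. \<phi> ` e \<in> edges_at N (\<phi> u)"
proof -
  obtain e where "e \<in> edges_at M u" "stretch M N \<phi> e > 0"
    using nondegenerate assms by (auto simp: nondegenerate_def)
  then show ?thesis using image_edge_at by (auto simp: stretch_def split: if_splits)
qed

lemma mult_eq:
  assumes "u \<in> verts M" "e' \<in> edges_at N (\<phi> u)"
  shows "mult M N \<phi> u = (\<Sum>e | e \<in> edges_at M u \<and> \<phi> ` e = e'. stretch M N \<phi> e)"
proof -
  have "(SOME e'. e' \<in> edges_at N (\<phi> u)) \<in> edges_at N (\<phi> u)" using assms(2) by (rule someI)
  then have "mult M N \<phi> u = mult_along M N \<phi> u e'"
    unfolding mult_def using harmonic assms unfolding harmonic_def by blast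
  then show ?thesis by (simp add: mult_along_def)
qed

lemma mult_ge_card:
  assumes "u \<in> verts M" "e' \<in> edges_at N (\<phi> u)"
  shows "card {e \<in> edges_at M u. \<phi> ` e = e'} \<le> mult M N \<phi> u"
proof -
  have "(\<Sum>e | e \<in> edges_at M u \<and> \<phi> ` e = e'. 1) \<le> mult M N \<phi> u"
    unfolding mult_eq[OF assms]
  proof (rule sum_mono)
    fix e assume "e \<in> {e. e \<in> edges_at M u \<and> \<phi> ` e = e'}"
    then have "stretch M N \<phi> e > 0"
      using stretch_pos assms(2) by (auto simp: edges_at_iff[OF M] edges_at_iff[OF N])
    then show "1 \<le> stretch M N \<phi> e" by simp
  qed
  then show ?thesis by simp
qed

lemma mult_pos: "u \<in> verts M \<Longrightarrow> mult M N \<phi> u \<ge> 1"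
proof -
  assume u: "u \<in> verts M"
  obtain e where e: "e \<in> edges_at M u" "\<phi> ` e \<in> edges_at N (\<phi> u)" using edge_over[OF u] by auto
  then have "card {f \<in> edges_at M u. \<phi> ` f = \<phi> ` e} > 0" using finite_edges(3) by (auto simp: card_gt_0_iff)
  then show ?thesis using mult_ge_card[OF u e(2)] by simp
qed

abbreviation deg :: "'a set \<Rightarrow> 'b \<Rightarrow> nat" where "deg \<equiv> degree_over M N \<phi>"

text \<open>
  Each edge over \<open>e'\<close> has exactly one end over \<open>y\<close>. So the edges of
  \<open>U\<close> over \<open>e'\<close> are distributed among the vertices of \<open>U\<close>
  over \<open>y\<close>, and the edges at one vertex add up to its multiplicity.
\<close>
lemma degree_over_eq_edge_sum:
  assumes y: "e' \<in> edges_at N y"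
    and sat: "\<And>u e. u \<in> verts M \<Longrightarrow> \<phi> u = y \<Longrightarrow> e \<in> edges_at M u \<Longrightarrow> u \<in> U \<longleftrightarrow> e \<subseteq> U"
  shows "(\<Sum>e | e \<in> edges M \<and> e \<subseteq> U \<and> \<phi> ` e = e'. stretch M N \<phi> e) = deg U y"
proof -
  have e': "e' \<in> edges N" "y \<in> ends N e'" using y by (auto simp: edges_at_iff[OF N])
  let ?A = "{u. u \<in> verts M \<and> u \<in> U \<and> \<phi> u = y}" and ?B = "\<lambda>u. {e. e \<in> edges_at M u \<and> \<phi> ` e = e'}"
  have "deg U y = (\<Sum>u\<in>?A. \<Sum>e\<in>?B u. stretch M N \<phi> e)"
    unfolding degree_over_def by (rule sum.cong) (use mult_eq y in auto)
  also have "\<dots> = (\<Sum>e\<in>(\<Union>u\<in>?A. ?B u). stretch M N \<phi> e)"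
  proof (rule sum.UNION_disjoint[symmetric])
    show "finite ?A" using finite_edges by simp
    show "\<forall>u\<in>?A. finite (?B u)" using finite_edges by simp
    show "\<forall>u\<in>?A. \<forall>w\<in>?A. u \<noteq> w \<longrightarrow> ?B u \<inter> ?B w = {}"
      using unique_end_over e' by (auto simp: edges_at_iff[OF M])
  qed
  also have "(\<Union>u\<in>?A. ?B u) = {e. e \<in> edges M \<and> e \<subseteq> U \<and> \<phi> ` e = e'}"
  proof
    show "(\<Union>u\<in>?A. ?B u) \<subseteq> {e. e \<in> edges M \<and> e \<subseteq> U \<and> \<phi> ` e = e'}"
      using sat by (auto simp: edges_at_iff[OF M])
    show "{e. e \<in> edges M \<and> e \<subseteq> U \<and> \<phi> ` e = e'} \<subseteq> (\<Union>u\<in>?A. ?B u)"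
    proof
      fix e assume "e \<in> {e. e \<in> edges M \<and> e \<subseteq> U \<and> \<phi> ` e = e'}"
      then have e: "e \<in> edges M" "e \<subseteq> U" "\<phi> ` e = e'" by auto
      then obtain u where u: "u \<in> ends M e" "\<phi> u = y" using ends_onto_ends[of e y] e' by auto
      then have "u \<in> verts M" "e \<in> edges_at M u" using ends_in_verts[OF M e(1)] e by (auto simp: edges_at_iff[OF M])
      then show "e \<in> (\<Union>u\<in>?A. ?B u)" using sat u e by auto
    qed
  qed
  finally show ?thesis by simp
qed

lemma degree_over_everything:
  assumes "u \<in> verts M"
  shows "deg UNIV (\<phi> u) = d"
proof -
  obtain e where e: "\<phi> ` e \<in> edges_at N (\<phi> u)" using edge_over[OF assms] by auto
  have "(\<Sum>f | f \<in> edges M \<and> f \<subseteq> UNIV \<and> \<phi> ` f = \<phi> ` e. stretch M N \<phi> f) = deg UNIV (\<phi> u)"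
    by (rule degree_over_eq_edge_sum[OF e]) auto
  moreover have "(\<Sum>f | f \<in> edges M \<and> \<phi> ` f = \<phi> ` e. stretch M N \<phi> f) = d"
    using degree e by (simp add: has_degree_def edges_at_iff[OF N])
  ultimately show ?thesis by simp
qed

text \<open>
  The degree extends to a function \<open>D\<close> on all points of the path, by counting edges
  over the interior of an edge. By the previous formula this function is locally constant on
  \<open>J\<close>.
\<close>
lemma degree_over_constant:
  assumes J: "connectedin (graph_topology N) J" and y: "y \<in> verts N" "y \<in> J" "z \<in> verts N" "z \<in> J"
    and sat: "\<And>u e. u \<in> verts M \<Longrightarrow> \<phi> u \<in> J \<Longrightarrow> e \<in> edges_at M u \<Longrightarrow> u \<in> U \<longleftrightarrow> e \<subseteq> U"
  shows "deg U y = deg U z"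
proof -
  let ?T = "graph_topology N"
  define D where "D p = (if p \<in> verts N then deg U p else
      (\<Sum>e | e \<in> edges M \<and> e \<subseteq> U \<and> \<phi> ` e \<in> edges N \<and> p \<in> \<phi> ` e. stretch M N \<phi> e))" for p
  have D_edge: "D p = (\<Sum>e | e \<in> edges M \<and> e \<subseteq> U \<and> \<phi> ` e = e'. stretch M N \<phi> e)"
    if "e' \<in> edges N" "p \<in> e'" for e' p
  proof -
    have "{e. e \<in> edges M \<and> e \<subseteq> U \<and> \<phi> ` e \<in> edges N \<and> p \<in> \<phi> ` e} = {e. e \<in> edges M \<and> e \<subseteq> U \<and> \<phi> ` e = e'}"
      using edge_unique[OF N _ that(1) _ that(2)] that by blast
    moreover have "p \<notin> verts N" using edge_verts_disjoint[OF N that] .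
    ultimately show ?thesis by (simp add: D_def)
  qed
  have loc: "\<exists>V. openin ?T V \<and> p \<in> V \<and> (\<forall>q\<in>V. D q = D p)" if p: "p \<in> J" for p
  proof (cases "p \<in> verts N")
    case True
    have "D q = D p" if "q \<in> e'" "e' \<in> edges_at N p" for q e'
    proof -
      have "D q = deg U p"
        using D_edge[of e' q] degree_over_eq_edge_sum[OF that(2), of U] sat that p by (auto simp: edges_at_iff[OF N])
      then show ?thesis using True by (simp add: D_def)
    qed
    then show ?thesis using openin_star[OF N True] by (intro exI[of _ "insert p (\<Union>(edges_at N p))"]) auto
  next
    case False
    then obtain e' where e': "e' \<in> edges N" "p \<in> e'"
      using connectedin_subset_topspace[OF J] p by (auto simp: topspace_graph[OF N] points_def)
    then have "D q = D p" if "q \<in> e'" for q using D_edge that by simp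
    then show ?thesis using openin_edge[OF N e'(1)] e' by blast
  qed
  define E where "E P = \<Union>{V. openin ?T V \<and> (\<forall>q\<in>V. P (D q))}" for P :: "nat \<Rightarrow> bool"
  have E_open: "openin ?T (E P)" for P unfolding E_def by (rule openin_Union) simp
  have E_iff: "p \<in> E P \<longleftrightarrow> P (D p)" if p: "p \<in> J" for p P
  proof
    assume "P (D p)"
    moreover obtain V where "openin ?T V" "p \<in> V" "\<forall>q\<in>V. D q = D p" using loc[OF p] by blast
    ultimately have "openin ?T V \<and> (\<forall>q\<in>V. P (D q))" "p \<in> V" by metis+
    then show "p \<in> E P" unfolding E_def by blast
  qed (auto simp: E_def)
  have "D z = D y"
  proof (rule ccontr)
    assume "D z \<noteq> D y"
    then have "y \<in> E (\<lambda>c. c = D y) \<inter> J" "z \<in> E (\<lambda>c. c \<noteq> D y) \<inter> J"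
      using y E_iff by auto
    moreover have "J \<subseteq> E (\<lambda>c. c = D y) \<union> E (\<lambda>c. c \<noteq> D y)" using E_iff by blast
    moreover have "E (\<lambda>c. c = D y) \<inter> E (\<lambda>c. c \<noteq> D y) \<inter> J = {}" using E_iff by auto
    ultimately show False using connectedinD[OF J E_open E_open] by blast
  qed
  then show ?thesis using y by (simp add: D_def)
qed

text \<open>
  A contracted edge of \<open>S\<close> has both ends in the same fibre. If \<open>u\<close> is the
  only vertex of \<open>S\<close> in that fibre, the edge is a contracted loop, which non-degeneracy
  forbids.
\<close>
lemma edge_at_sole_fibre_vertex:
  assumes S: "without_cut_points (graph_topology M) S" and e: "e \<in> edges M" "e \<inter> S \<noteq> {}" 
    and u: "u \<in> ends M e" and only: "\<And>w. w \<in> verts M \<Longrightarrow> w \<in> S \<Longrightarrow> \<phi> w = \<phi> u \<Longrightarrow> w = u"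
  shows "\<phi> ` e \<in> edges N"
proof (rule ccontr)
  assume "\<not> ?thesis"
  then obtain y where y: "\<phi> ` e = {y}" using edge_cases[OF e(1)] by auto
  have "w = u" if "w \<in> ends M e" for w
    using only[of w] that end_of_contracted[OF e(1) y] u edge_subset[OF M S e] ends_in_verts[OF M e(1)] by auto
  moreover have "bounded_edge M e" by (rule edge_bounded[OF M S e])
  ultimately have "is_loop M e" using ends_eq[OF M e(1)] by (auto simp: is_loop_def)
  then show False using no_loop by blast
qed

text \<open>
  Two vertices in the fibre contribute at least 1 each. If \<open>u\<close> is the only one, the two
  edges of \<open>S\<close> at \<open>u\<close> are not contracted. They lie over the same side of
  \<open>\<phi> u\<close>, because \<open>S\<close> without \<open>u\<close> is connected and does
  not return to the fibre; so they lie over the same edge.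
\<close>
lemma circle_fibre:
  assumes S: "without_cut_points (graph_topology M) S" and u: "u \<in> verts M" "u \<in> S" and U: "S \<subseteq> U"
  shows "deg U (\<phi> u) \<ge> 2"
proof (cases "\<exists>w\<in>verts M. w \<in> S \<and> \<phi> w = \<phi> u \<and> w \<noteq> u")
  case True
  then obtain w where w: "w \<in> verts M" "w \<in> S" "\<phi> w = \<phi> u" "w \<noteq> u" by auto
  have "(\<Sum>x\<in>{u, w}. mult M N \<phi> x) \<le> deg U (\<phi> u)"
    unfolding degree_over_def using u w U finite_edges by (intro sum_mono2) auto
  then show ?thesis using w mult_pos[OF u(1)] mult_pos[OF w(1)] by simp
next
  case False
  then have only: "w = u" if "w \<in> verts M" "w \<in> S" "\<phi> w = \<phi> u" for w using that by blast
  obtain e f where ef: "e \<in> edges_at M u" "f \<in> edges_at M u" "e \<subseteq> S" "f \<subseteq> S" "e \<noteq> f"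
    using two_edges_at_vertex[OF M S u] no_loop by metis
  then have E: "e \<in> edges M" "f \<in> edges M" "u \<in> ends M e" "u \<in> ends M f" by (auto simp: edges_at_iff[OF M])
  have ne: "g \<inter> S \<noteq> {}" if "g \<in> edges M" "g \<subseteq> S" for g
    using infinite_edge[OF M that(1)] that by (metis Int_absorb2 finite.emptyI)
  have im: "\<phi> ` e \<in> edges N"
    by (rule edge_at_sole_fibre_vertex[OF S E(1) ne[OF E(1) ef(3)] E(3)], erule (2) only)
  have im': "\<phi> ` f \<in> edges N"
    by (rule edge_at_sole_fibre_vertex[OF S E(2) ne[OF E(2) ef(4)] E(4)], erule (2) only)
  have off: "\<phi> u \<notin> \<phi> ` (S - {u})"
  proof
    assume "\<phi> u \<in> \<phi> ` (S - {u})"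
    then obtain x where x: "x \<in> S" "x \<noteq> u" "\<phi> x = \<phi> u" by (metis DiffE imageE singletonI)
    then have "x \<notin> verts M" using only by blast
    then obtain g where g: "g \<in> edges M" "x \<in> g" using subset_points[OF M S] x by (auto simp: points_def)
    then have gS: "g \<inter> S \<noteq> {}" using x by auto
    have "\<phi> u \<in> \<phi> ` g" using g x by (metis imageI)
    then have notE: "\<phi> ` g \<notin> edges N" using edge_verts_disjoint[OF N] phi_verts[OF u(1)] by blast
    then obtain y where "\<phi> ` g = {y}" using edge_cases[OF g(1)] by auto
    then have y: "\<phi> ` g = {\<phi> u}" using \<open>\<phi> u \<in> \<phi> ` g\<close> by auto
    let ?w = "src M g"
    have w: "?w \<in> ends M g" by (rule src_in_ends[OF M g(1)])
    have wS: "?w \<in> verts M" "?w \<in> S" "\<phi> ?w = \<phi> u"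
      using w edge_subset[OF M S g(1) gS] ends_in_verts[OF M g(1)] end_of_contracted[OF g(1) y w] by auto
    then have "?w = u" by (rule only)
    have "\<phi> ` g \<in> edges N"
    proof (rule edge_at_sole_fibre_vertex[OF S g(1) gS w])
      fix x assume "x \<in> verts M" "x \<in> S" "\<phi> x = \<phi> ?w"
      then show "x = ?w" using only[of x] wS(3) \<open>?w = u\<close> by simp
    qed
    then show False using notE by simp
  qed
  have conn: "connectedin (graph_topology N) (\<phi> ` (S - {u}))"
    using S connectedin_continuous_map_image[OF phi_continuous] by (auto simp: without_cut_points_def)
  have side: "(\<forall>q\<in>\<phi> ` (S - {u}). h q < h (\<phi> u)) \<or> (\<forall>q\<in>\<phi> ` (S - {u}). h (\<phi> u) < h q)"
    using one_sided[OF conn _ off] phi_verts[OF u(1)] vert_point by blast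
  obtain a b where ab: "a \<in> e" "b \<in> f"
    using infinite_imp_nonempty[OF infinite_edge[OF M E(1)]]
      infinite_imp_nonempty[OF infinite_edge[OF M E(2)]] by blast
  have "a \<in> S - {u}" "b \<in> S - {u}" using ab ef u edge_verts_disjoint[OF M] E by auto
  then have "h (\<phi> a) < h (\<phi> u) \<and> h (\<phi> b) < h (\<phi> u) \<or> h (\<phi> u) < h (\<phi> a) \<and> h (\<phi> u) < h (\<phi> b)"
    using side by blast
  then have eq: "\<phi> ` e = \<phi> ` f"
    using edges_on_one_side[OF image_edge_at[OF ef(1) im] image_edge_at[OF ef(2) im'], of "\<phi> a" "\<phi> b"] ab
    by blast
  have "card {e, f} \<le> card {g \<in> edges_at M u. \<phi> ` g = \<phi> ` e}"
    using ef eq finite_edges by (intro card_mono) auto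
  then have "2 \<le> mult M N \<phi> u"
    using mult_ge_card[OF u(1) image_edge_at[OF ef(1) im]] ef by simp
  also have "\<dots> = (\<Sum>x\<in>{u}. mult M N \<phi> x)" by simp
  also have "\<dots> \<le> deg U (\<phi> u)"
    unfolding degree_over_def using u U finite_edges by (intro sum_mono2) auto
  finally show ?thesis .
qed

end

section \<open>The three circles over the path\<close>

text \<open>
  A point inside an edge has a neighbourhood which, without the point, consists of two arcs. Each
  arc lies in one part, so at most two of the three parts accumulate there.
\<close>
lemma branch_point_vertex:
  assumes mg: "metric_graph M" and cr: "crowded_space (graph_topology M) v1 v2 U W S"
  shows "v1 \<in> verts M"
proof (rule ccontr)
  let ?T = "graph_topology M"
  assume not: "v1 \<notin> verts M"
  have ne: "v1 \<noteq> v2" by (rule crowded_space_cover(1)[OF cr])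
  have pts: "v1 \<in> points M" "v2 \<in> points M"
    using crowded_space_cover(2,3)[OF cr] by (simp_all add: topspace_graph[OF mg])
  then obtain e where e: "e \<in> edges M" "v1 \<in> e" using not by (auto simp: points_def)
  then obtain c where c: "c \<in> open_dom M e" "v1 = chart M e c"
    using edge_chart[OF mg e(1)] by (metis imageE)
  have inj: "chart M e s = chart M e t \<longleftrightarrow> s = t" if "s \<in> open_dom M e" "t \<in> open_dom M e" for s t
    using chart_inj[OF mg e(1)] that by (simp add: inj_on_eq_iff)
  (* The neighbourhood of v1 must avoid v2 for its two arcs to lie in the parts. *)
  define Z where "Z = open_dom M e - {t \<in> closed_dom M e. chart M e t = v2}"
  have "closed {t \<in> closed_dom M e. chart M e t = v2}"
    using closedin_singleton[OF mg pts(2)] e by (simp add: closedin_graph_topology[OF mg])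
  then have "open Z" unfolding Z_def using open_open_dom by auto
  moreover have "c \<in> Z" using c ne by (auto simp: Z_def)
  ultimately obtain r where r: "r > 0" "ball c r \<subseteq> Z" by (meson open_contains_ball)
  then have near: "t \<in> open_dom M e \<and> chart M e t \<noteq> v2" if "c - r < t" "t < c + r" for t
  proof -
    have "t \<in> ball c r" using that by (auto simp: dist_real_def)
    then have "t \<in> Z" using r by blast
    then show ?thesis using open_dom_subset[of M e] by (auto simp: Z_def)
  qed
  define L where "L = chart M e ` {c - r<..<c}"
  define R where "R = chart M e ` {c<..<c + r}"
  have sub: "{c - r<..<c} \<subseteq> open_dom M e" "{c<..<c + r} \<subseteq> open_dom M e" "{c - r<..<c + r} \<subseteq> open_dom M e"
    using near r by auto
  have conn: "connectedin ?T L" "connectedin ?T R"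
    unfolding L_def R_def using sub open_dom_subset[of M e]
    by (auto intro!: connectedin_arc[OF mg e(1)] simp: is_interval_oo)
  have avoid: "v1 \<notin> L" "v2 \<notin> L" "v1 \<notin> R" "v2 \<notin> R"
  proof -
    have "x \<noteq> v1 \<and> x \<noteq> v2" if x: "x \<in> L \<union> R" for x
    proof -
      obtain t where t: "x = chart M e t" "c - r < t" "t < c + r" "t \<noteq> c"
        using x r unfolding L_def R_def by fastforce
      then show ?thesis using near[OF t(2,3)] inj[OF c(1), of t] c(2) by auto
    qed
    then show "v1 \<notin> L" "v2 \<notin> L" "v1 \<notin> R" "v2 \<notin> R" by blast+
  qed
  have "{c - r<..<c + r} = insert c ({c - r<..<c} \<union> {c<..<c + r})" using r by auto
  then have nbhd: "chart M e ` {c - r<..<c + r} = insert v1 (L \<union> R)"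
    unfolding L_def R_def c(2) by (metis image_Un image_insert)
  have "(L \<union> R) \<inter> U i \<noteq> {}" if i: "i \<in> {1,2,3}" for i
  proof -
    have "openin ?T (insert v1 (L \<union> R))"
      using open_arc[OF mg e(1) _ sub(3)] nbhd by simp
    moreover have "v1 \<in> ?T closure_of W i" by (rule crowded_spaceD(6)[OF cr i])
    ultimately have "W i \<inter> insert v1 (L \<union> R) \<noteq> {}" by (auto simp: in_closure_of)
    then show ?thesis using crowded_spaceD(2,4)[OF cr i] by blast
  qed
  then have "L \<inter> U i \<noteq> {} \<or> R \<inter> U i \<noteq> {}" if "i \<in> {1,2,3}" for i using that by blast
  then have in_one: "L \<subseteq> U i \<or> R \<subseteq> U i" if "i \<in> {1,2,3}" for i
    using connected_in_one_part[OF cr that conn(1) avoid(1,2)] 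
      connected_in_one_part[OF cr that conn(2) avoid(3,4)] that by blast
  have nonempty: "L \<noteq> {}" "R \<noteq> {}" using r by (auto simp: L_def R_def)
  have disj: "U (1::nat) \<inter> U 2 = {}" "U (1::nat) \<inter> U 3 = {}" "U (2::nat) \<inter> U 3 = {}"
    using crowded_spaceD(10)[OF cr, of 1 2] crowded_spaceD(10)[OF cr, of 1 3] crowded_spaceD(10)[OF cr, of 2 3] by auto
  have "L \<subseteq> U 1 \<or> R \<subseteq> U 1" "L \<subseteq> U 2 \<or> R \<subseteq> U 2" "L \<subseteq> U 3 \<or> R \<subseteq> U 3"
    by (rule in_one; simp)+
  then show False using nonempty disj by blast
qed

lemma star_in_one_part:
  assumes mg: "metric_graph M" and cr: "crowded_space (graph_topology M) v1 v2 U W S" and i: "i \<in> {1,2,3}"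
    and u: "u \<noteq> v1" "u \<noteq> v2" "e \<in> edges_at M u"
  shows "u \<in> U i \<longleftrightarrow> e \<subseteq> U i"
proof -
  have e: "e \<in> edges M" "u \<in> ends M e" using u by (auto simp: edges_at_iff[OF mg])
  have "v1 \<in> verts M" "v2 \<in> verts M"
    using branch_point_vertex[OF mg cr] branch_point_vertex[OF mg crowded_space_swap[OF cr]] .
  then have "v1 \<notin> insert u e" "v2 \<notin> insert u e" using edge_verts_disjoint[OF mg e(1)] u by auto
  moreover have "connectedin (graph_topology M) (insert u e)"
    using e by (intro connectedin_edge_with_ends[OF mg e(1)]) auto
  ultimately have "insert u e \<inter> U i \<noteq> {} \<Longrightarrow> insert u e \<subseteq> U i"
    using connected_in_one_part[OF cr i] by blast
  moreover have "e \<noteq> {}" using infinite_edge[OF mg e(1)] by auto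
  ultimately show ?thesis by blast
qed

context path_cover
begin

context
  fixes v1 v2 U W S
  assumes cr: "crowded_space (graph_topology M) v1 v2 U W S" and d: "d = 3"
begin

lemma v_verts: "v1 \<in> verts M" "v2 \<in> verts M"
  using branch_point_vertex[OF M cr] branch_point_vertex[OF M crowded_space_swap[OF cr]] .

text \<open>
  A vertex over the segment is neither \<open>v1\<close> nor \<open>v2\<close>, so it lies in the
  same part as the edges at it.
\<close>
lemma degree_over_between:
  assumes i: "i \<in> {1,2,3}" and y: "y \<in> verts N" "z \<in> verts N" "h y < h z"
    and away: "h (\<phi> v1) < h y \<or> h z < h (\<phi> v1)" "h (\<phi> v2) < h y \<or> h z < h (\<phi> v2)"
  shows "deg (U i) y = deg (U i) z"
proof (rule degree_over_constant)
  have sub: "{h y..h z} \<subseteq> I"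
    using mem_is_interval_1_I[OF interval h_in_I[OF vert_point(1)[OF y(1)]] h_in_I[OF vert_point(1)[OF y(2)]]]
    by auto
  show "connectedin (graph_topology N) (k ` {h y..h z})" by (rule connectedin_segment[OF sub])
  have "y = k (h y)" "z = k (h z)" using k_h vert_point(1) y by simp_all
  then show "y \<in> k ` {h y..h z}" "z \<in> k ` {h y..h z}"
    using y(3) by (metis atLeastAtMost_iff imageI less_imp_le order_refl)+
  fix u e assume u: "u \<in> verts M" "\<phi> u \<in> k ` {h y..h z}" "e \<in> edges_at M u"
  then have "h (\<phi> u) \<in> {h y..h z}" using h_k sub by auto
  then have "u \<noteq> v1" "u \<noteq> v2" using away by auto
  then show "u \<in> U i \<longleftrightarrow> e \<subseteq> U i" by (rule star_in_one_part[OF M cr i _ _ u(3)])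
qed (use y in auto)

lemma circle_vertex:
  assumes "i \<in> {1,2,3}"
  shows "\<exists>u\<in>verts M. u \<in> W i \<and> 2 \<le> deg (U i) (\<phi> u)"
proof -
  note c = crowded_spaceD[OF cr assms]
  obtain u where u: "u \<in> verts M" "u \<in> S i" using contains_vertex[OF M c(9)] by auto
  then show ?thesis using circle_fibre[OF c(9) u, of "U i"] c(4,8) by blast
qed

lemma degree_over_two_parts:
  assumes "i \<in> {1,2,3}" "j \<in> {1,2,3}" "i \<noteq> j" "u \<in> verts M"
  shows "deg (U i) (\<phi> u) + deg (U j) (\<phi> u) \<le> 3"
proof -
  let ?F = "\<lambda>A. {w. w \<in> verts M \<and> w \<in> A \<and> \<phi> w = \<phi> u}"
  have disj: "U i \<inter> U j = {}" by (rule crowded_spaceD(10)[OF cr assms(1,2,3)])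
  have "deg (U i) (\<phi> u) + deg (U j) (\<phi> u) = (\<Sum>w\<in>?F (U i) \<union> ?F (U j). mult M N \<phi> w)"
    unfolding degree_over_def
    by (rule sum.union_disjoint[symmetric]) (use finite_edges disj in auto)
  also have "\<dots> \<le> deg UNIV (\<phi> u)"
    unfolding degree_over_def using finite_edges by (intro sum_mono2) auto
  finally show ?thesis using degree_over_everything[OF assms(4)] d by simp
qed

lemma at_most_one_other:
  assumes j: "j \<in> {1,2,3}" "2 \<le> deg (U j) y"
    and a: "a \<in> verts M" "\<phi> a = y" "a \<notin> U j" and b: "b \<in> verts M" "\<phi> b = y" "b \<notin> U j"
  shows "a = b"
proof (rule ccontr)
  assume ne: "a \<noteq> b"
  let ?F = "\<lambda>A. {w. w \<in> verts M \<and> w \<in> A \<and> \<phi> w = y}"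
  have "deg (U j) y + (mult M N \<phi> a + mult M N \<phi> b) = (\<Sum>w\<in>?F (U j) \<union> {a, b}. mult M N \<phi> w)"
    unfolding degree_over_def using finite_edges a b ne by (subst sum.union_disjoint) auto
  also have "\<dots> \<le> deg UNIV y"
    unfolding degree_over_def using finite_edges a b by (intro sum_mono2) auto
  finally show False using degree_over_everything[OF a(1)] a(2) d j(2) mult_pos[OF a(1)] mult_pos[OF b(1)] by simp
qed

text \<open>
  If no vertex of \<open>U i\<close> lies over \<open>y\<close>, a point of \<open>W i\<close> over
  \<open>y\<close> would lie in a contracted edge whose ends are outside \<open>U i\<close>. That
  edge would be open and closed in \<open>W i\<close>, hence all of \<open>W i\<close>, although
  \<open>W i\<close> contains the vertex \<open>u\<close>. So the connected image of
  \<open>W i\<close> stays strictly on the side of \<open>\<phi> u\<close>, and in the limit so do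
  \<open>\<phi> v1\<close> and \<open>\<phi> v2\<close>, possibly reaching \<open>y\<close>.
\<close>
lemma branch_one_sided:
  assumes i: "i \<in> {1,2,3}" and y: "y \<in> verts N" and u: "u \<in> verts M" "u \<in> W i"
    and none: "\<And>s. s \<in> verts M \<Longrightarrow> s \<in> U i \<Longrightarrow> \<phi> s \<noteq> y" and v: "v = v1 \<or> v = v2"
  shows "h (\<phi> u) < h y \<Longrightarrow> h (\<phi> v) \<le> h y" "h y < h (\<phi> u) \<Longrightarrow> h y \<le> h (\<phi> v)"
proof -
  let ?T = "graph_topology M"
  note c = crowded_spaceD[OF cr i]
  have off: "y \<notin> \<phi> ` W i"
  proof
    assume "y \<in> \<phi> ` W i"
    then obtain x where x: "x \<in> W i" "\<phi> x = y" by auto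
    then have "x \<notin> verts M" using none c(4) by blast
    moreover have "x \<in> points M"
      using connectedin_subset_topspace[OF c(5)] x by (auto simp: topspace_graph[OF M])
    ultimately obtain e where e: "e \<in> edges M" "x \<in> e" by (auto simp: points_def)
    have "y \<in> \<phi> ` e" using e x by (metis imageI)
    then have "\<phi> ` e \<notin> edges N" using edge_verts_disjoint[OF N] y by blast
    then obtain z where "\<phi> ` e = {z}" using edge_cases[OF e(1)] by blast
    then have ey: "\<phi> ` e = {y}" using \<open>y \<in> \<phi> ` e\<close> by simp
    have "w \<notin> U i" if "w \<in> ends M e" for w
      using none[of w] end_of_contracted[OF e(1) ey that] ends_in_verts[OF M e(1)] that by blast
    then have "W i \<inter> e = W i \<inter> (e \<union> ends M e)" using c(4) by blast
    then have "W i \<inter> e = {} \<or> W i \<subseteq> e"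
      by (rule connectedin_open_closed[OF c(5) openin_edge[OF M e(1)] closedin_closed_edge[OF M e(1)]])
    then show False using x e u edge_verts_disjoint[OF M e(1)] by blast
  qed
  have "connectedin (graph_topology N) (\<phi> ` W i)"
    by (rule connectedin_continuous_map_image[OF phi_continuous c(5)])
  from one_sided[OF this vert_point(1)[OF y] off]
  have side: "(\<forall>x\<in>W i. h (\<phi> x) < h y) \<or> (\<forall>x\<in>W i. h y < h (\<phi> x))" by auto
  have "continuous_map ?T euclideanreal (h \<circ> \<phi>)"
    by (rule continuous_map_compose[OF phi_continuous h_continuous])
  moreover have "v \<in> ?T closure_of W i" using v c(6,7) by auto
  ultimately have cl: "h (\<phi> v) \<in> closure ((h \<circ> \<phi>) ` W i)"
    using continuous_map_image_closure_subset[of ?T euclideanreal "h \<circ> \<phi>" "W i"] by fastforce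
  show "h (\<phi> v) \<le> h y" if "h (\<phi> u) < h y"
  proof -
    have "(h \<circ> \<phi>) ` W i \<subseteq> {..h y}" using side that u by force
    then have "closure ((h \<circ> \<phi>) ` W i) \<subseteq> {..h y}" by (rule closure_minimal) simp
    then show ?thesis using cl by auto
  qed
  show "h y \<le> h (\<phi> v)" if "h y < h (\<phi> u)"
  proof -
    have "(h \<circ> \<phi>) ` W i \<subseteq> {h y..}" using side that u by force
    then have "closure ((h \<circ> \<phi>) ` W i) \<subseteq> {h y..}" by (rule closure_minimal) simp
    then show ?thesis using cl by auto
  qed
qed

text \<open>
  The cases are which of the two outer parts meet the middle fibre. Not both do, since only one
  vertex of that fibre lies outside \<open>U j\<close>.
\<close>
lemma no_three_in_order:
  assumes I: "i \<in> {1,2,3}" "j \<in> {1,2,3}" "l \<in> {1,2,3}" "i \<noteq> j" "j \<noteq> l" "i \<noteq> l"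
    and a: "a \<in> verts M" "a \<in> W i" "2 \<le> deg (U i) (\<phi> a)"
    and b: "b \<in> verts M" "2 \<le> deg (U j) (\<phi> b)"
    and c: "c \<in> verts M" "c \<in> W l" "2 \<le> deg (U l) (\<phi> c)"
    and order: "h (\<phi> a) < h (\<phi> b)" "h (\<phi> b) < h (\<phi> c)"
  shows False
proof -
  let ?y = "\<phi> b"
  have Y: "\<phi> a \<in> verts N" "?y \<in> verts N" "\<phi> c \<in> verts N" using a b c phi_verts by auto
  have vneq: "v1 \<noteq> v2" by (rule crowded_space_cover(1)[OF cr])
  have vU: "v1 \<notin> U m" "v2 \<notin> U m" if "m \<in> {1,2,3}" for m using crowded_spaceD(2,3)[OF cr that] .
  have heq: "h (\<phi> v) = h ?y \<Longrightarrow> \<phi> v = ?y" if "v \<in> verts M" for v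
    using h_inj phi_points vert_point that b(1) by metis
  note one = at_most_one_other[OF I(2) b(2)]
  have Udisj: "U i \<inter> U j = {}" "U l \<inter> U j = {}" "U i \<inter> U l = {}"
    using crowded_spaceD(10)[OF cr] I by metis+
  (* One of the outer parts misses the middle fibre, and then pulls v1 and v2 to its own side. *)
  define hit where "hit m \<longleftrightarrow> (\<exists>s\<in>verts M. s \<in> U m \<and> \<phi> s = ?y)" for m
  have not_hit: "\<phi> s \<noteq> ?y" if "\<not> hit m" "s \<in> verts M" "s \<in> U m" for m s
    using that by (auto simp: hit_def)
  have left: "h (\<phi> v1) \<le> h ?y" "h (\<phi> v2) \<le> h ?y" if "\<not> hit i"
    using branch_one_sided(1)[OF I(1) Y(2) a(1,2) not_hit[OF that] _ order(1)] by blast+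
  have right: "h ?y \<le> h (\<phi> v1)" "h ?y \<le> h (\<phi> v2)" if "\<not> hit l"
    using branch_one_sided(2)[OF I(3) Y(2) c(1,2) not_hit[OF that] _ order(2)] by blast+
  consider "hit i" "hit l" | "\<not> hit i" "\<not> hit l" | "\<not> hit i" "hit l" | "hit i" "\<not> hit l" by blast
  then show False
  proof cases
    case 1
    then obtain s t where "s \<in> verts M" "s \<in> U i" "\<phi> s = ?y" "t \<in> verts M" "t \<in> U l" "\<phi> t = ?y"
      unfolding hit_def by blast
    then show False using one[of s t] Udisj by blast
  next
    case 2
    then have "\<phi> v1 = ?y" "\<phi> v2 = ?y" using left right heq v_verts by (meson order.antisym)+
    then show False using one[of v1 v2] v_verts vU[OF I(2)] vneq by blast
  next
    case 3
    then obtain s where s: "s \<in> verts M" "s \<in> U l" "\<phi> s = ?y" unfolding hit_def by blast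
    then have "\<phi> v1 \<noteq> ?y" "\<phi> v2 \<noteq> ?y"
      using one[of s v1] one[of s v2] v_verts vU[OF I(2)] vU[OF I(3)] Udisj by blast+
    then have "h (\<phi> v1) < h ?y" "h (\<phi> v2) < h ?y"
      using left[OF 3(1)] heq v_verts by (meson order.not_eq_order_implies_strict)+
    then have "deg (U l) ?y = deg (U l) (\<phi> c)" by (intro degree_over_between[OF I(3) Y(2,3) order(2)]) auto
    then show False using degree_over_two_parts[OF I(2,3,5) b(1)] b(2) c(3) by simp
  next
    case 4
    then obtain s where s: "s \<in> verts M" "s \<in> U i" "\<phi> s = ?y" unfolding hit_def by blast
    then have "\<phi> v1 \<noteq> ?y" "\<phi> v2 \<noteq> ?y"
      using one[of s v1] one[of s v2] v_verts vU[OF I(2)] vU[OF I(1)] Udisj by blast+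
    then have "h ?y < h (\<phi> v1)" "h ?y < h (\<phi> v2)"
      using right[OF 4(2)] heq v_verts by (metis order.not_eq_order_implies_strict)+
    then have "deg (U i) (\<phi> a) = deg (U i) ?y" by (intro degree_over_between[OF I(1) Y(1,2) order(1)]) auto
    then show False using degree_over_two_parts[OF I(1,2,4) b(1)] b(2) a(3) by simp
  qed
qed

lemma no_crowded_cover: False
proof -
  have "\<exists>u. u \<in> verts M \<and> u \<in> W i \<and> 2 \<le> deg (U i) (\<phi> u)" if "i \<in> {1,2,3}" for i
    using circle_vertex[OF that] by blast
  then obtain u where u: "\<And>i. i \<in> {1,2,3} \<Longrightarrow> u i \<in> verts M \<and> u i \<in> W i \<and> 2 \<le> deg (U i) (\<phi> (u i))"
    by metis
  have ne: "h (\<phi> (u i)) \<noteq> h (\<phi> (u j))" if ij: "i \<in> {1,2,3}" "j \<in> {1,2,3}" "i \<noteq> j" for i j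
  proof
    assume "h (\<phi> (u i)) = h (\<phi> (u j))"
    then have "\<phi> (u i) = \<phi> (u j)" using h_inj phi_verts vert_point(1) u ij by metis
    then show False using degree_over_two_parts[OF ij, of "u i"] u[OF ij(1)] u[OF ij(2)] by simp
  qed
  have order: False
    if "i \<in> {1,2,3}" "j \<in> {1,2,3}" "l \<in> {1,2,3}" "i \<noteq> j" "j \<noteq> l" "i \<noteq> l"
      "h (\<phi> (u i)) < h (\<phi> (u j))" "h (\<phi> (u j)) < h (\<phi> (u l))" for i j l
    using no_three_in_order[OF that(1-6), of "u i" "u j" "u l"] that u by blast
  define p where "p i = h (\<phi> (u i))" for i
  have p_ne: "p 1 \<noteq> p 2" "p 2 \<noteq> p 3" "p 1 \<noteq> p 3" unfolding p_def by (rule ne; simp)+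
  have unordered: "\<not> (p i < p j \<and> p j < p l)"
    if "i \<in> {1,2,3}" "j \<in> {1,2,3}" "l \<in> {1,2,3}" "i \<noteq> j" "j \<noteq> l" "i \<noteq> l" for i j l
    using order[OF that] unfolding p_def by blast
  have "\<not> (p 1 < p 2 \<and> p 2 < p 3)" "\<not> (p 1 < p 3 \<and> p 3 < p 2)" "\<not> (p 2 < p 1 \<and> p 1 < p 3)"
    "\<not> (p 2 < p 3 \<and> p 3 < p 1)" "\<not> (p 3 < p 1 \<and> p 1 < p 2)" "\<not> (p 3 < p 2 \<and> p 2 < p 1)"
    by (rule unordered; simp)+
  with p_ne show False by linarith
qed

end
end

section \<open>Crowded patterns have no well-contracted cover of degree 3\<close>

theorem lemma5p3:
  fixes \<Gamma> \<Gamma>' :: "'a model" and g :: "'a \<Rightarrow> nat"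
  assumes "tropical_curve \<Gamma> g"
    and "has_crowded_pattern \<Gamma>"
    and "tropical_modification \<Gamma> \<Gamma>'"
  shows "\<not> (\<exists>(P :: 'b model) (\<phi> :: 'a \<Rightarrow> 'b). well_contracted_cover \<Gamma>' P \<phi> 3)"
proof
  assume "\<exists>(P :: 'b model) (\<phi> :: 'a \<Rightarrow> 'b). well_contracted_cover \<Gamma>' P \<phi> 3"
  then obtain P :: "'b model" and \<phi> M N where P: "metric_path P"
    and models: "model_of M \<Gamma>'" "model_of N P"
    and cover: "tropical_cover M N \<phi> 3" "nondegenerate M N \<phi>"
    by (auto simp: well_contracted_cover_def)
  obtain I :: "real set" where I: "is_interval I" "graph_topology P homeomorphic_space top_of_set I"
    using P by (auto simp: metric_path_def)
  then obtain h k where "homeomorphic_maps (graph_topology N) (top_of_set I) h k"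
    using model_of_same_topology(1)[OF models(2)] by (auto simp: homeomorphic_space_def)
  then interpret path_cover M N \<phi> 3 h k I
    using cover I by unfold_locales (auto simp: tropical_cover_def)
  have "metric_graph \<Gamma>" using assms(1) by (simp add: tropical_curve_def connected_graph_def)
  then have "is_crowded (graph_topology \<Gamma>')" using crowded_pattern_modification assms by blast
  then have "is_crowded (graph_topology M)" by (simp add: model_of_same_topology(1)[OF models(1)])
  then show False using no_crowded_cover by (auto simp: is_crowded_def)
qed

end
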